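(* Let $a<b$ and consider the Sturm-Liouville eigenvalue problem $$ \begin{cases}-\partial_x\left(p(x)\partial_xu(x)\right) +q(x)u(x) = \lambda w(x)u(x) & x\in (a,b),\\ \sigma_1 u(a) - \sigma_2 p(a)u'(a) =0,\\ \zeta_1 u(b) +\zeta_2 p(b)u'(b) =0, \end{cases}\qquad (P) $$ where $p,p',w,w',q,(pw)',(pw)''\in C([a,b])$, $p,w>0$, $q\ge0$, $\sigma_1^2+\sigma_2^2>0$ and $\zeta_1^2+\zeta_2^2>0$. Let $\lambda_k(\mathcal{L})$ denote the $k$-th eigenvalue of $(P)$ and put $B=\int_a^b\sqrt{w(x)/p(x)}\,dx$. Let $\mathcal{L}^{(n)}$ be the $n\times n$ discrete operator of $(P)$ obtained by means of a matrix method such that: (a) $\lim_{n\to\infty}\lambda_k(\mathcal{L}^{(n)})=\lambda_k(\mathcal{L})$ for every fixed $k$; (b) $\lambda_k(\mathcal{L}^{(n)})\in\mathbb{R}$ for every $k=1,\dots,n$; (c) $\{(n+1)^{-2}\mathcal{L}^{(n)}\}_n\sim_\lambda\omega(x,\theta)$, $(x,\theta)\in[a,b]\times[0,\pi]$, with $\omega\in L^\infty([a,b]\times[0,\pi])$ real; (d) the monotone rearrangement $\tilde\omega:[0,1]\to[\min R_\omega,\max R_\omega]$ of $\omega$ is piecewise Lipschitz. If $$ \sup_{x\in(0,1]}\left|\frac{\tilde\omega(x)}{x^2\pi^2/B^2}-1\right|>0, $$ then the numerical method cannot provide a relative uniform approximation of the eigenvalues of the continuous operator, i.e. $\max_{k=1,\ldots,n}\left|\frac{\lambda_k(\mathcal{L}^{(n)})}{\lambda_k(\mathcal{L})}-1\right|$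 does not converge to $0$ as $n\to\infty$. In particular, for this conclusion it is enough that $$ \sup_{(x,\theta)\in[a,b]\times[0,\pi]}\omega(x,\theta)=\tilde\omega(1)\neq\frac{\pi^2}{B^2}. $$
   Context: Eigenvalues are always listed in non-decreasing order $\lambda_1\le\lambda_2\le\cdots$. Spectral symbol: for a sequence of $n\times n$ matrices $\{T^{(n)}\}_n$ and a measurable $\omega:D\subset\mathbb{R}^m\to\mathbb{C}$ with $0<\mu_m(D)<\infty$ ($\mu_m$ Lebesgue measure), $\{T^{(n)}\}_n\sim_\lambda\omega$ means that for all $F\in C_c(\mathbb{C})$, $$\lim_{n\to\infty}\frac1n\sum_{k=1}^nF(\lambda_k(T^{(n)}))=\frac1{\mu_m(D)}\int_DF(\omega(\mathbf{x}))\,d\mu_m(\mathbf{x}).$$ Essential range: $R_\omega=\{t:\mu_m(\{\mathbf{x}\in D:|\omega(\mathbf{x})-t|<\epsilon\})>0\ \forall\epsilon>0\}$. Monotone rearrangement of a real-valued $\omega$: with $\phi(t)=\frac{1}{\mu_m(D)}\mu_m\{\mathbf{x}\in D:\omega(\mathbf{x})\le t\}$, set $\tilde\omega(x)=\inf\{t\in[\inf R_\omega,\sup R_\omega]:\phi(t)\ge x\}$ for $x\in[0,1]$. *)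

theory Defs
  imports
    "HOL-Probability.Essential_Supremum"
    "Jordan_Normal_Form.Char_Poly"
begin

text \<open>Matrix eigenvalues are listed with algebraic multiplicity, in non-decreasing order of their
  real parts (the order of non-real eigenvalues with equal real parts is left open); the index
  \<open>k\<close> of \<open>mat_eigenvalue\<close> and of \<open>sl_eigenvalue\<close> starts at 1.\<close>

definition eigenvalue_list :: "complex mat \<Rightarrow> complex list" where
  "eigenvalue_list A = (SOME es. char_poly A = (\<Prod>e\<leftarrow>es. [:- e, 1:]) \<and>
     length es = dim_row A \<and> sorted_wrt (\<lambda>x y. Re x \<le> Re y) es)"

definition mat_eigenvalue :: "complex mat \<Rightarrow> nat \<Rightarrow> complex" where
  "mat_eigenvalue A k = eigenvalue_list A ! (k - 1)"

lemma eigenvalue_list: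
  assumes "A \<in> carrier_mat n n"
  shows "char_poly A = (\<Prod>e\<leftarrow>eigenvalue_list A. [:- e, 1:])"
    and "length (eigenvalue_list A) = n"
    and "sorted_wrt (\<lambda>x y. Re x \<le> Re y) (eigenvalue_list A)"
proof -
  obtain es where es: "char_poly A = (\<Prod>e\<leftarrow>es. [:- e, 1:])" "length es = n"
    using char_poly_factorized[OF assms] by blast
  have "mset (map (\<lambda>e. [:- e, 1:]) (sort_key Re es)) = mset (map (\<lambda>e. [:- e, 1:]) es)"
    by simp
  then have "(\<Prod>e\<leftarrow>sort_key Re es. [:- e, 1:]) = (\<Prod>e\<leftarrow>es. [:- e, 1:])"
    by (metis prod_mset_prod_list)
  moreover have "sorted_wrt (\<lambda>x y. Re x \<le> Re y) (sort_key Re es)"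
    using sorted_sort_key[of Re es] by (simp add: sorted_map)
  ultimately have "\<exists>es. char_poly A = (\<Prod>e\<leftarrow>es. [:- e, 1:]) \<and>
     length es = dim_row A \<and> sorted_wrt (\<lambda>x y. Re x \<le> Re y) es"
    using es assms by (intro exI[of _ "sort_key Re es"]) auto
  note spec = someI_ex[OF this, folded eigenvalue_list_def]
  show "char_poly A = (\<Prod>e\<leftarrow>eigenvalue_list A. [:- e, 1:])"
    and "length (eigenvalue_list A) = n"
    and "sorted_wrt (\<lambda>x y. Re x \<le> Re y) (eigenvalue_list A)"
    using spec carrier_matD(1)[OF assms] by argo+
qed

definition has_spectral_symbol ::
  "(nat \<Rightarrow> complex mat) \<Rightarrow> 'a::euclidean_space set \<Rightarrow> ('a \<Rightarrow> complex) \<Rightarrow> bool" where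
  "has_spectral_symbol T D \<omega> \<longleftrightarrow>
     D \<in> lmeasurable \<and> 0 < measure lebesgue D \<and> \<omega> \<in> borel_measurable (lebesgue_on D) \<and>
     (\<forall>F::complex \<Rightarrow> complex. continuous_on UNIV F \<and> compact (closure {z. F z \<noteq> 0}) \<longrightarrow>
        (\<lambda>n. (\<Sum>k=1..n. F (mat_eigenvalue (T n) k)) / of_nat n)
          \<longlonglongrightarrow> (LINT x|lebesgue_on D. F (\<omega> x)) / of_real (measure lebesgue D))"

definition ess_range :: "'a::euclidean_space set \<Rightarrow> ('a \<Rightarrow> 'b::real_normed_vector) \<Rightarrow> 'b set" where
  "ess_range D \<omega> = {t. \<forall>\<epsilon>>0. 0 < measure lebesgue {x\<in>D. norm (\<omega> x - t) < \<epsilon>}}"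

definition distribution_fun :: "'a::euclidean_space set \<Rightarrow> ('a \<Rightarrow> real) \<Rightarrow> real \<Rightarrow> real" where
  "distribution_fun D \<omega> t = measure lebesgue {x\<in>D. \<omega> x \<le> t} / measure lebesgue D"

definition monotone_rearrangement :: "'a::euclidean_space set \<Rightarrow> ('a \<Rightarrow> real) \<Rightarrow> real \<Rightarrow> real" where
  "monotone_rearrangement D \<omega> x =
     Inf {t \<in> {Inf (ess_range D \<omega>)..Sup (ess_range D \<omega>)}. distribution_fun D \<omega> t \<ge> x}"

text \<open>Jumps at the finitely many breakpoints are allowed.\<close>

definition piecewise_lipschitz_on :: "real \<Rightarrow> real \<Rightarrow> (real \<Rightarrow> real) \<Rightarrow> bool" where
  "piecewise_lipschitz_on a b f \<longleftrightarrow>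
     (\<exists>(t::nat \<Rightarrow> real) m. t 0 = a \<and> t m = b \<and> (\<forall>i<m. t i < t (Suc i)) \<and>
        (\<forall>i<m. \<exists>C. C-lipschitz_on {t i<..<t (Suc i)} f))"

text \<open>\<open>f\<close> is \<open>k\<close> times continuously differentiable on \<open>[a, b]\<close>, with one-sided derivatives at the
  end points.\<close>

primrec Ck_on :: "nat \<Rightarrow> real \<Rightarrow> real \<Rightarrow> (real \<Rightarrow> real) \<Rightarrow> bool" where
  "Ck_on 0 a b f \<longleftrightarrow> continuous_on {a..b} f"
| "Ck_on (Suc k) a b f \<longleftrightarrow>
     (\<exists>f'. (\<forall>x\<in>{a..b}. (f has_real_derivative f' x) (at x within {a..b})) \<and> Ck_on k a b f')"

text \<open>The function \<open>u\<close> with derivative \<open>u'\<close> is a classical solution of the boundary value problem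
  that is continuously differentiable up to the boundary.\<close>

definition sl_solution ::
  "real \<Rightarrow> real \<Rightarrow> (real \<Rightarrow> real) \<Rightarrow> (real \<Rightarrow> real) \<Rightarrow> (real \<Rightarrow> real) \<Rightarrow> real \<Rightarrow> real \<Rightarrow> real \<Rightarrow> real \<Rightarrow>
   real \<Rightarrow> (real \<Rightarrow> real) \<Rightarrow> (real \<Rightarrow> real) \<Rightarrow> bool" where
  "sl_solution a b p q w \<sigma>1 \<sigma>2 \<zeta>1 \<zeta>2 lam u u' \<longleftrightarrow>
     (\<forall>x\<in>{a..b}. (u has_real_derivative u' x) (at x within {a..b})) \<and>
     continuous_on {a..b} u' \<and>
     (\<forall>x\<in>{a<..<b}. \<exists>d. ((\<lambda>y. p y * u' y) has_real_derivative d) (at x) \<and>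
        - d + q x * u x = lam * w x * u x) \<and>
     \<sigma>1 * u a - \<sigma>2 * p a * u' a = 0 \<and>
     \<zeta>1 * u b + \<zeta>2 * p b * u' b = 0"

definition sl_eigenvalues ::
  "real \<Rightarrow> real \<Rightarrow> (real \<Rightarrow> real) \<Rightarrow> (real \<Rightarrow> real) \<Rightarrow> (real \<Rightarrow> real) \<Rightarrow> real \<Rightarrow> real \<Rightarrow> real \<Rightarrow> real \<Rightarrow>
   real set" where
  "sl_eigenvalues a b p q w \<sigma>1 \<sigma>2 \<zeta>1 \<zeta>2 =
     {lam. \<exists>u u'. sl_solution a b p q w \<sigma>1 \<sigma>2 \<zeta>1 \<zeta>2 lam u u' \<and> (\<exists>x\<in>{a..b}. u x \<noteq> 0)}"

text \<open>With separated boundary conditions every eigenvalue is simple (the Wronskian of two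
  solutions vanishes at \<open>a\<close>), so listing the eigenvalues with multiplicity is the same as
  enumerating this set increasingly.\<close>

definition sl_eigenvalue ::
  "real \<Rightarrow> real \<Rightarrow> (real \<Rightarrow> real) \<Rightarrow> (real \<Rightarrow> real) \<Rightarrow> (real \<Rightarrow> real) \<Rightarrow> real \<Rightarrow> real \<Rightarrow> real \<Rightarrow> real \<Rightarrow>
   nat \<Rightarrow> real" where
  "sl_eigenvalue a b p q w \<sigma>1 \<sigma>2 \<zeta>1 \<zeta>2 k =
     (let E = sl_eigenvalues a b p q w \<sigma>1 \<sigma>2 \<zeta>1 \<zeta>2
      in THE lam. lam \<in> E \<and> finite {\<mu>\<in>E. \<mu> < lam} \<and> card {\<mu>\<in>E. \<mu> < lam} = k - 1)"

text \<open>An index with \<open>lam k = 0\<close>, for which the quotient is undefined, is left out. At most one index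
  is affected for a Sturm-Liouville problem (e.g. \<open>k = 1\<close> for \<open>q = 0\<close> and Neumann conditions).\<close>

definition max_relative_error :: "(nat \<Rightarrow> complex mat) \<Rightarrow> (nat \<Rightarrow> real) \<Rightarrow> nat \<Rightarrow> real" where
  "max_relative_error L lam n =
     Max ((\<lambda>k. cmod (mat_eigenvalue (L n) k / of_real (lam k) - 1)) ` {k\<in>{1..n}. lam k \<noteq> 0})"

end

theory Submission
  imports Defs
begin

text \<open>Suppose that the relative errors tend to \<open>0\<close> uniformly, and put \<open>c = \<pi>\<^sup>2 / B\<^sup>2\<close>. Weyl's law for the
  Sturm-Liouville problem (\<open>sl_eigenvalue_weyl_law\<close>) says \<open>\<lambda>\<^sub>k / k\<^sup>2 \<longlonglongrightarrow> c\<close>, so the eigenvalues of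
  \<open>L n / (n + 1)\<^sup>2\<close> are \<open>c (k / n)\<^sup>2 + o(1)\<close>, uniformly in \<open>k\<close> outside a bounded initial range of indices
  (\<open>scaled_eigenvalues_approx\<close>). Their empirical distribution therefore converges to the distribution
  of \<open>c x\<^sup>2\<close> for \<open>x\<close> uniform on \<open>[0, 1]\<close>. By the definition of a spectral symbol it also converges to
  the distribution of \<open>\<omega>\<close>. Hence \<open>\<omega>\<close> has the distribution function of \<open>c x\<^sup>2\<close>, and its
  generalised inverse, the monotone rearrangement, is \<open>c x\<^sup>2\<close> at every point of \<open>(0, 1]\<close>
  (\<open>monotone_rearrangement_eq_if_scaled_squares\<close>). Both sufficient conditions in the theorem contradict
  this. The essential supremum and the rearrangement at \<open>1\<close> agree because both are the supremum of the
  essential range.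

  Weyl's law comes from the Pruefer angle. Writing \<open>u = v sin \<theta>\<close> and \<open>p u' = v cos \<theta>\<close> turns the
  equation into a first-order equation for \<open>\<theta>\<close> alone, with a right-hand side that is Lipschitz in
  \<open>\<theta>\<close>. The boundary condition at \<open>a\<close> fixes \<open>\<theta>(a)\<close>, and the one at \<open>b\<close> says that \<open>\<theta>(b)\<close>
  is congruent to a fixed angle modulo \<open>\<pi>\<close>. As a function of the spectral parameter, \<open>\<theta>(b)\<close> is
  continuous, strictly increasing, bounded below and equal to \<open>B \<surd>\<lambda> + O(1)\<close>. So the eigenvalues form
  an increasing sequence in which the angle grows by exactly \<open>\<pi>\<close> from one to the next, and
  \<open>B \<surd>\<lambda>\<^sub>k = k \<pi> + O(1)\<close>.\<close>

section \<open>Gronwall-type comparison\<close>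

text \<open>Weighting \<open>g\<^sup>2\<close> by \<open>exp (2 K x)\<close> makes it non-decreasing and weighting it by \<open>exp (- 2 K x)\<close>
  makes it non-increasing, so a zero at \<open>c\<close> spreads to both sides.\<close>

lemma zero_if_derivative_dominated:
  fixes g :: "real \<Rightarrow> real"
  assumes cont: "continuous_on {a..b} g"
    and der: "\<And>x. x \<in> {a<..<b} \<Longrightarrow> (g has_real_derivative g' x) (at x)"
    and bound: "\<And>x. x \<in> {a<..<b} \<Longrightarrow> \<bar>g' x\<bar> \<le> K * \<bar>g x\<bar>"
    and c: "c \<in> {a..b}" "g c = 0" and x: "x \<in> {a..b}"
  shows "g x = 0"
proof -
  have gg: "\<bar>g y * g' y\<bar> \<le> K * (g y)\<^sup>2" if "y \<in> {a<..<b}" for y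
  proof -
    have "\<bar>g y * g' y\<bar> \<le> \<bar>g y\<bar> * (K * \<bar>g y\<bar>)"
      using mult_left_mono[OF bound[OF that], of "\<bar>g y\<bar>"] by (simp add: abs_mult)
    also have "\<dots> = K * (g y)\<^sup>2" by (simp add: power2_eq_square)
    finally show ?thesis .
  qed
  have sub: "continuous_on {u..v} g" "\<And>y. y \<in> {u<..<v} \<Longrightarrow> y \<in> {a<..<b}"
    if "u \<in> {a..b}" "v \<in> {a..b}" for u v
    using that by (auto intro: continuous_on_subset[OF cont])
  have der2: "((\<lambda>y. (g y)\<^sup>2 * exp (m * y)) has_real_derivative
      (2 * (g y * g' y) + m * (g y)\<^sup>2) * exp (m * y)) (at y)" if "y \<in> {a<..<b}" for y m
    by (auto intro!: derivative_eq_intros der[OF that] simp: algebra_simps power2_eq_square)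
  show ?thesis
  proof (cases "x \<le> c")
    case True
    have "(g x)\<^sup>2 * exp (2 * K * x) \<le> (g c)\<^sup>2 * exp (2 * K * c)"
    proof (rule DERIV_nonneg_imp_increasing_open[OF True])
      fix y assume "x < y" "y < c"
      then have y: "y \<in> {a<..<b}" using sub(2)[OF x c(1)] by auto
      show "\<exists>d. ((\<lambda>y. (g y)\<^sup>2 * exp (2 * K * y)) has_real_derivative d) (at y) \<and> 0 \<le> d"
        by (intro exI conjI, rule der2[OF y]) (use gg[OF y] in auto)
    qed (intro continuous_intros sub x c)
    then show ?thesis using c(2) by (simp add: mult_le_0_iff)
  next
    case False
    then have "c \<le> x" by simp
    have "(g x)\<^sup>2 * exp (- (2 * K) * x) \<le> (g c)\<^sup>2 * exp (- (2 * K) * c)"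
    proof (rule DERIV_nonpos_imp_decreasing_open[OF \<open>c \<le> x\<close>])
      fix y assume "c < y" "y < x"
      then have y: "y \<in> {a<..<b}" using sub(2)[OF c(1) x] by auto
      show "\<exists>d. ((\<lambda>y. (g y)\<^sup>2 * exp (- (2 * K) * y)) has_real_derivative d) (at y) \<and> d \<le> 0"
        by (intro exI conjI, rule der2[OF y]) (use gg[OF y] in \<open>auto intro!: mult_nonpos_nonneg\<close>)
    qed (intro continuous_intros sub x c)
    then show ?thesis using c(2) by (simp add: mult_le_0_iff)
  qed
qed

text \<open>If \<open>d x < 0\<close>, then the lower bound reads \<open>d' \<ge> K d\<close> from the last point before \<open>x\<close> with
  \<open>d \<ge> 0\<close> onwards, and \<open>d exp (- K x)\<close> cannot decrease there.\<close>

lemma nonneg_if_derivative_bounded_below: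
  fixes d :: "real \<Rightarrow> real"
  assumes cont: "continuous_on {a..b} d"
    and der: "\<And>x. x \<in> {a<..<b} \<Longrightarrow> (d has_real_derivative d' x) (at x)"
    and bound: "\<And>x. x \<in> {a<..<b} \<Longrightarrow> - K * \<bar>d x\<bar> \<le> d' x"
    and a: "0 \<le> d a" and x: "x \<in> {a..b}"
  shows "0 \<le> d x"
proof (rule ccontr)
  assume neg: "\<not> 0 \<le> d x"
  define S where "S = {y \<in> {a..x}. d y \<in> {0..}}"
  have contx: "continuous_on {a..x} d"
    using x by (auto intro: continuous_on_subset[OF cont])
  have "closed S"
    using continuous_closed_preimage[OF contx, of "{0..}"]
    by (simp add: S_def vimage_def Int_def)
  moreover have "a \<in> S" using a x by (auto simp: S_def)
  moreover have bdd: "bdd_above S" by (auto simp: S_def bdd_above_def)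
  ultimately have s: "Sup S \<in> S" by (intro closed_contains_Sup) auto
  define s where "s = Sup S"
  have s_le: "s \<le> x" "a \<le> s" and ds: "0 \<le> d s" using s by (auto simp: S_def s_def)
  have after: "d y < 0" if "s < y" "y \<le> x" for y
  proof (rule ccontr)
    assume "\<not> d y < 0"
    then have "y \<in> S" using that s_le by (auto simp: S_def)
    then show False using cSup_upper[OF _ bdd, of y] that by (simp add: s_def)
  qed
  have "d s * exp (- K * s) \<le> d x * exp (- K * x)"
  proof (rule DERIV_nonneg_imp_increasing_open[OF s_le(1)])
    fix y assume y: "s < y" "y < x"
    then have y': "y \<in> {a<..<b}" using x s_le by auto
    have "((\<lambda>y. d y * exp (- K * y)) has_real_derivative (d' y - K * d y) * exp (- K * y)) (at y)"
      by (auto intro!: derivative_eq_intros der[OF y'] simp: algebra_simps)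
    moreover have "0 \<le> d' y - K * d y" using bound[OF y'] after[of y] y by simp
    ultimately show "\<exists>e. ((\<lambda>y. d y * exp (- K * y)) has_real_derivative e) (at y) \<and> 0 \<le> e"
      by auto
  qed (use s_le in \<open>intro continuous_intros continuous_on_subset[OF contx], auto\<close>)
  moreover have "0 \<le> d s * exp (- K * s)" using ds by simp
  ultimately show False using neg by (smt (verit) exp_gt_zero mult_neg_pos)
qed

section \<open>Global solutions of scalar Lipschitz equations\<close>

text \<open>Picard iteration. Measured with the weight \<open>exp (2 M (x - a))\<close>, where \<open>M\<close> is a positive
  Lipschitz constant, every step halves the distance of consecutive iterates, so that they converge
  uniformly on the whole interval at once.\<close>

lemma scalar_ode_solution_exists:
  fixes f :: "real \<Rightarrow> real \<Rightarrow> real"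
  assumes ab: "a \<le> b"
    and cont: "continuous_on ({a..b} \<times> UNIV) (\<lambda>(x, y). f x y)"
    and lip: "\<And>x y z. x \<in> {a..b} \<Longrightarrow> \<bar>f x y - f x z\<bar> \<le> K * \<bar>y - z\<bar>"
  obtains \<theta> where "\<theta> a = y\<^sub>0"
    and "\<And>x. x \<in> {a..b} \<Longrightarrow> (\<theta> has_real_derivative f x (\<theta> x)) (at x within {a..b})"
proof -
  define M where "M = max K 1"
  have M: "0 < M" and lipM: "\<And>x y z. x \<in> {a..b} \<Longrightarrow> \<bar>f x y - f x z\<bar> \<le> M * \<bar>y - z\<bar>"
    using lip by (force simp: M_def intro: order_trans[OF _ mult_right_mono])+
  have cont_comp: "continuous_on {a..b} (\<lambda>s. f s (g s))" if "continuous_on {a..b} g" for g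
  proof -
    have "continuous_on {a..b} ((\<lambda>(x, y). f x y) \<circ> (\<lambda>s. (s, g s)))"
      using that by (intro continuous_on_compose continuous_on_subset[OF cont] continuous_intros) auto
    then show ?thesis by (simp add: o_def)
  qed
  define Y where "Y = rec_nat (\<lambda>x. y\<^sub>0) (\<lambda>n g x. y\<^sub>0 + integral {a..x} (\<lambda>s. f s (g s)))"
  have Y0: "Y 0 = (\<lambda>x. y\<^sub>0)"
    and Y_Suc: "Y (Suc n) = (\<lambda>x. y\<^sub>0 + integral {a..x} (\<lambda>s. f s (Y n s)))" for n
    by (simp_all add: Y_def)
  have Y_cont: "continuous_on {a..b} (Y n)" for n
  proof (induction n)
    case (Suc n)
    show ?case unfolding Y_Suc
      by (intro continuous_intros indefinite_integral_continuous_1 integrable_continuous_real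
          cont_comp Suc)
  qed (simp add: Y0)
  have int: "(\<lambda>s. f s (Y n s)) integrable_on {a..x}" if "x \<in> {a..b}" for n x
    using that by (intro integrable_continuous_real continuous_on_subset[OF cont_comp[OF Y_cont]]) auto
  obtain C where C: "0 \<le> C" "\<And>x. x \<in> {a..b} \<Longrightarrow> \<bar>Y 1 x - Y 0 x\<bar> \<le> C"
  proof -
    have "bounded ((\<lambda>x. Y 1 x - Y 0 x) ` {a..b})"
      by (intro compact_imp_bounded compact_continuous_image continuous_intros Y_cont compact_Icc)
    then obtain C where "\<And>x. x \<in> {a..b} \<Longrightarrow> \<bar>Y 1 x - Y 0 x\<bar> \<le> C"
      unfolding bounded_iff ball_simps real_norm_def by blast
    with that[of C] ab show ?thesis by (meson abs_ge_zero atLeastAtMost_iff order_refl order_trans)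
  qed
  have step: "\<bar>Y (Suc n) x - Y n x\<bar> \<le> C * (1/2) ^ n * exp (2 * M * (x - a))"
    if "x \<in> {a..b}" for n x
    using that
  proof (induction n arbitrary: x)
    case 0
    have "C * 1 \<le> C * exp (2 * M * (x - a))"
      using 0 M C(1) by (intro mult_left_mono) auto
    then show ?case using C(2)[OF 0] by simp
  next
    case (Suc n)
    let ?e = "\<lambda>s. M * (C * (1/2) ^ n * exp (2 * M * (s - a)))"
    let ?E = "\<lambda>s. C * (1/2) ^ Suc n * exp (2 * M * (s - a))"
    have E: "(?e has_integral (?E x - ?E a)) {a..x}"
    proof (rule fundamental_theorem_of_calculus)
      show "a \<le> x" using Suc.prems by simp
      fix s show "(?E has_vector_derivative ?e s) (at s within {a..x})"
        unfolding has_real_derivative_iff_has_vector_derivative[symmetric]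
        by (auto intro!: derivative_eq_intros simp: field_simps)
    qed
    have "Y (Suc (Suc n)) x - Y (Suc n) x
        = integral {a..x} (\<lambda>s. f s (Y (Suc n) s) - f s (Y n s))"
      using integral_diff[OF int[OF Suc.prems, of "Suc n"] int[OF Suc.prems, of n]]
        fun_cong[OF Y_Suc[of "Suc n"], of x] fun_cong[OF Y_Suc[of n], of x] by linarith
    also have "\<bar>\<dots>\<bar> \<le> integral {a..x} ?e"
    proof (rule integral_norm_bound_integral[where 'a=real, unfolded real_norm_def])
      show "(\<lambda>s. f s (Y (Suc n) s) - f s (Y n s)) integrable_on {a..x}"
        using Suc.prems by (intro integrable_diff int)
      show "?e integrable_on {a..x}" using E by (rule has_integral_integrable)
      fix s assume "s \<in> {a..x}"
      then have s: "s \<in> {a..b}" using Suc.prems by auto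
      show "\<bar>f s (Y (Suc n) s) - f s (Y n s)\<bar> \<le> ?e s"
        using mult_left_mono[OF Suc.IH[OF s], of M] lipM[OF s] M by (meson less_imp_le order_trans)
    qed
    also have "\<dots> = ?E x - ?E a" using E by (rule integral_unique)
    also have "\<dots> \<le> ?E x" using C by simp
    finally show ?case .
  qed
  define D where "D = C * exp (2 * M * (b - a))"
  have step': "norm (Y (Suc n) x - Y n x) \<le> D * (1/2) ^ n" if "x \<in> {a..b}" for n x
  proof -
    have "C * (1/2) ^ n * exp (2 * M * (x - a)) \<le> C * (1/2) ^ n * exp (2 * M * (b - a))"
      using that M C(1) by (intro mult_left_mono) auto
    then show ?thesis using step[OF that, of n] by (simp add: D_def mult_ac)
  qed
  define \<theta> where "\<theta> = (\<lambda>x. y\<^sub>0 + (\<Sum>i. Y (Suc i) x - Y i x))"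
  have "uniform_limit {a..b} (\<lambda>n x. \<Sum>i<n. Y (Suc i) x - Y i x)
      (\<lambda>x. \<Sum>i. Y (Suc i) x - Y i x) sequentially"
    by (rule Weierstrass_m_test[OF step']) (auto intro!: summable_mult summable_geometric)
  then have "uniform_limit {a..b} (\<lambda>n x. y\<^sub>0 + (\<Sum>i<n. Y (Suc i) x - Y i x)) \<theta> sequentially"
    unfolding \<theta>_def by (intro uniform_limit_intros)
  moreover have "y\<^sub>0 + (\<Sum>i<n. Y (Suc i) x - Y i x) = Y n x" for n x
    using sum_lessThan_telescope[of "\<lambda>i. Y i x" n] by (simp add: Y0)
  ultimately have lim: "uniform_limit {a..b} Y \<theta> sequentially" by simp
  have \<theta>_cont: "continuous_on {a..b} \<theta>"
    by (rule uniform_limit_theorem[OF _ lim]) (auto simp: Y_cont)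
  have \<theta>_eq: "\<theta> x = y\<^sub>0 + integral {a..x} (\<lambda>s. f s (\<theta> s))" if x: "x \<in> {a..b}" for x
  proof (rule LIMSEQ_unique)
    show "(\<lambda>n. Y (Suc n) x) \<longlonglongrightarrow> \<theta> x"
      using tendsto_uniform_limitI[OF lim x] by (rule LIMSEQ_Suc)
    have "uniform_limit {a..x} (\<lambda>n s. f s (Y n s)) (\<lambda>s. f s (\<theta> s)) sequentially"
    proof (rule uniform_limitI)
      fix e :: real assume "0 < e"
      then have "0 < e / M" using M by simp
      from uniform_limitD[OF lim this]
      show "\<forall>\<^sub>F n in sequentially. \<forall>s\<in>{a..x}. dist (f s (Y n s)) (f s (\<theta> s)) < e"
      proof (rule eventually_mono, intro ballI)
        fix n s assume *: "\<forall>s\<in>{a..b}. dist (Y n s) (\<theta> s) < e / M" and "s \<in> {a..x}"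
        then have s: "s \<in> {a..b}" using x by auto
        have "dist (f s (Y n s)) (f s (\<theta> s)) \<le> M * dist (Y n s) (\<theta> s)"
          using lipM[OF s] by (simp add: dist_real_def)
        also have "\<dots> < e" using * s M by (simp add: field_simps)
        finally show "dist (f s (Y n s)) (f s (\<theta> s)) < e" .
      qed
    qed
    moreover have "continuous_on {a..x} (\<lambda>s. f s (Y n s))" for n
      using x by (intro continuous_on_subset[OF cont_comp[OF Y_cont]]) auto
    ultimately obtain I J where IJ: "\<And>n. ((\<lambda>s. f s (Y n s)) has_integral I n) {a..x}"
      "((\<lambda>s. f s (\<theta> s)) has_integral J) {a..x}" "I \<longlonglongrightarrow> J"
      by (rule uniform_limit_integral[OF _ _ sequentially_bot]) blast
    from IJ(3) show "(\<lambda>n. Y (Suc n) x) \<longlonglongrightarrow> y\<^sub>0 + integral {a..x} (\<lambda>s. f s (\<theta> s))"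
      unfolding Y_Suc integral_unique[OF IJ(1)] integral_unique[OF IJ(2)] by (rule tendsto_add[OF tendsto_const])
  qed
  show ?thesis
  proof (rule that[of \<theta>])
    show "\<theta> a = y\<^sub>0" using \<theta>_eq[of a] ab by simp
    fix x assume x: "x \<in> {a..b}"
    have "((\<lambda>x. y\<^sub>0 + integral {a..x} (\<lambda>s. f s (\<theta> s))) has_real_derivative f x (\<theta> x)) (at x within {a..b})"
      by (rule derivative_eq_intros integral_has_real_derivative[OF cont_comp[OF \<theta>_cont] x] refl | simp)+
    then show "(\<theta> has_real_derivative f x (\<theta> x)) (at x within {a..b})"
      by (rule has_field_derivative_transform_within[OF _ _ x, where d = 1]) (simp_all add: \<theta>_eq)
  qed
qed

section \<open>The Pruefer angle\<close>

locale sturm_liouville =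
  fixes a b :: real and p q w :: "real \<Rightarrow> real"
  assumes ab: "a < b"
    and cont: "continuous_on {a..b} p" "continuous_on {a..b} q" "continuous_on {a..b} w"
    and p_pos: "\<And>x. x \<in> {a..b} \<Longrightarrow> 0 < p x"
    and w_pos: "\<And>x. x \<in> {a..b} \<Longrightarrow> 0 < w x"
begin

text \<open>Substituting \<open>u = v sin \<theta>\<close> and \<open>p u' = v cos \<theta>\<close> into \<open>- (p u')' + q u = lam w u\<close> and
  eliminating the derivative of the amplitude \<open>v\<close> leaves \<open>\<theta>' = prufer_rhs lam x \<theta>\<close>.\<close>

definition prufer_rhs :: "real \<Rightarrow> real \<Rightarrow> real \<Rightarrow> real" where
  "prufer_rhs lam x y = (cos y)\<^sup>2 / p x + (lam * w x - q x) * (sin y)\<^sup>2"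

definition prufer :: "real \<Rightarrow> real \<Rightarrow> real \<Rightarrow> real" where
  "prufer \<alpha> lam = (SOME \<theta>. \<theta> a = \<alpha> \<and> (\<forall>x\<in>{a..b}.
     (\<theta> has_real_derivative prufer_rhs lam x (\<theta> x)) (at x within {a..b})))"

lemma coefficient_bound:
  obtains K where "0 \<le> K"
    "\<And>lam x. \<lbrakk>\<bar>lam\<bar> \<le> N; x \<in> {a..b}\<rbrakk> \<Longrightarrow> 1 / p x + \<bar>q x\<bar> + \<bar>lam\<bar> * w x \<le> K"
proof -
  have "continuous_on {a..b} (\<lambda>x. 1 / p x + \<bar>q x\<bar> + N * w x)"
    by (intro continuous_intros cont) (use p_pos in force)
  then have "bounded ((\<lambda>x. 1 / p x + \<bar>q x\<bar> + N * w x) ` {a..b})"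
    by (intro compact_imp_bounded compact_continuous_image) auto
  then obtain K where K: "\<And>x. x \<in> {a..b} \<Longrightarrow> \<bar>1 / p x + \<bar>q x\<bar> + N * w x\<bar> \<le> K"
    unfolding bounded_iff ball_simps real_norm_def by blast
  have "0 \<le> K" using K[of a] ab by auto
  moreover have "1 / p x + \<bar>q x\<bar> + \<bar>lam\<bar> * w x \<le> K" if "\<bar>lam\<bar> \<le> N" "x \<in> {a..b}" for lam x
    using abs_le_D1[OF K[OF that(2)]] mult_right_mono[OF that(1), of "w x"] w_pos[OF that(2)] by linarith
  ultimately show ?thesis using that by blast
qed

lemma prufer_rhs_lipschitz:
  assumes "1 / p x + \<bar>q x\<bar> + \<bar>lam\<bar> * w x \<le> K" "x \<in> {a..b}"
  shows "\<bar>prufer_rhs lam x y - prufer_rhs lam x z\<bar> \<le> K * \<bar>y - z\<bar>"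
proof -
  have sin2: "(sin y)\<^sup>2 - (sin z)\<^sup>2 = sin (y - z) * sin (y + z)"
  proof -
    have "sin (y - z) * sin (y + z) = (sin y)\<^sup>2 * (cos z)\<^sup>2 - (cos y)\<^sup>2 * (sin z)\<^sup>2"
      by (simp add: sin_diff sin_add power2_eq_square algebra_simps)
    then show ?thesis by (simp add: cos_squared_eq algebra_simps)
  qed
  have "prufer_rhs lam x y - prufer_rhs lam x z
      = (lam * w x - q x - 1 / p x) * ((sin y)\<^sup>2 - (sin z)\<^sup>2)"
    by (simp add: prufer_rhs_def cos_squared_eq diff_divide_distrib algebra_simps)
  also have "\<bar>\<dots>\<bar> = \<bar>lam * w x - q x - 1 / p x\<bar> * (\<bar>sin (y - z)\<bar> * \<bar>sin (y + z)\<bar>)"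
    by (simp add: sin2 abs_mult)
  also have "\<dots> \<le> K * (\<bar>y - z\<bar> * 1)"
  proof (intro mult_mono)
    have "\<bar>lam * w x\<bar> = \<bar>lam\<bar> * w x" using w_pos[OF assms(2)] by (simp add: abs_mult)
    then show "\<bar>lam * w x - q x - 1 / p x\<bar> \<le> K" using assms(1) p_pos[OF assms(2)]
      by (smt (verit) zero_less_divide_1_iff)
    then show "0 \<le> K" by linarith
    show "\<bar>sin (y - z)\<bar> \<le> \<bar>y - z\<bar>" by (rule abs_sin_x_le_abs_x)
  qed auto
  finally show ?thesis by simp
qed

lemma prufer_rhs_continuous:
  "continuous_on ({a..b} \<times> UNIV) (\<lambda>(x, y). prufer_rhs lam x y)"
proof -
  have fst: "continuous_on ({a..b} \<times> (UNIV :: real set)) (\<lambda>z. g (fst z))"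
    if "continuous_on {a..b} g" for g :: "real \<Rightarrow> real"
    using continuous_on_compose[OF continuous_on_fst[OF continuous_on_id],
        of "{a..b} \<times> (UNIV :: real set)" g] that
    by (simp add: o_def)
  show ?thesis
    unfolding prufer_rhs_def split_def
    by (intro continuous_intros fst cont) (use p_pos in force)
qed

lemma prufer_init: "prufer \<alpha> lam a = \<alpha>"
  and prufer_deriv: "x \<in> {a..b} \<Longrightarrow>
    (prufer \<alpha> lam has_real_derivative prufer_rhs lam x (prufer \<alpha> lam x)) (at x within {a..b})"
proof -
  obtain K where "\<And>x. x \<in> {a..b} \<Longrightarrow> 1 / p x + \<bar>q x\<bar> + \<bar>lam\<bar> * w x \<le> K"
    using coefficient_bound[of "\<bar>lam\<bar>"] by (metis order_refl)
  then obtain \<theta> where "\<theta> a = \<alpha> \<and> (\<forall>x\<in>{a..b}.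
     (\<theta> has_real_derivative prufer_rhs lam x (\<theta> x)) (at x within {a..b}))"
    using scalar_ode_solution_exists[of a b "prufer_rhs lam" K \<alpha>] ab
      prufer_rhs_continuous prufer_rhs_lipschitz by (metis less_imp_le)
  from someI[of "\<lambda>\<theta>. \<theta> a = \<alpha> \<and> (\<forall>x\<in>{a..b}.
     (\<theta> has_real_derivative prufer_rhs lam x (\<theta> x)) (at x within {a..b}))", OF this,
     folded prufer_def]
  show "prufer \<alpha> lam a = \<alpha>" "x \<in> {a..b} \<Longrightarrow>
    (prufer \<alpha> lam has_real_derivative prufer_rhs lam x (prufer \<alpha> lam x)) (at x within {a..b})"
    by blast+
qed

lemma prufer_deriv_at:
  "x \<in> {a<..<b} \<Longrightarrow>
    (prufer \<alpha> lam has_real_derivative prufer_rhs lam x (prufer \<alpha> lam x)) (at x)"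
  using prufer_deriv[of x \<alpha> lam] at_within_Icc_at[of a x b] by simp

lemma prufer_continuous: "continuous_on {a..b} (prufer \<alpha> lam)"
  using prufer_deriv by (rule DERIV_continuous_on)

text \<open>An angle at level \<open>0\<close> can only rise, because the right-hand side equals \<open>1 / p > 0\<close> there. This
  bound, uniform in \<open>lam\<close>, is the reason why there is a lowest eigenvalue.\<close>

lemma prufer_nonneg:
  assumes "0 \<le> \<alpha>" "x \<in> {a..b}"
  shows "0 \<le> prufer \<alpha> lam x"
proof -
  obtain K where K: "\<And>x. x \<in> {a..b} \<Longrightarrow> 1 / p x + \<bar>q x\<bar> + \<bar>lam\<bar> * w x \<le> K"
    using coefficient_bound[of "\<bar>lam\<bar>"] by (metis order_refl)
  show ?thesis
  proof (rule nonneg_if_derivative_bounded_below[OF prufer_continuous prufer_deriv_at, where K = K])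
    fix x assume "x \<in> {a<..<b}"
    then have x: "x \<in> {a..b}" by auto
    have "0 < prufer_rhs lam x 0" using p_pos[OF x] by (simp add: prufer_rhs_def)
    then show "- K * \<bar>prufer \<alpha> lam x\<bar> \<le> prufer_rhs lam x (prufer \<alpha> lam x)"
      using prufer_rhs_lipschitz[OF K[OF x] x, of "prufer \<alpha> lam x" 0] by simp
  qed (use assms in \<open>auto simp: prufer_init\<close>)
qed

text \<open>This splits the change of the right-hand side into the effect of the spectral parameter, which has
  a sign, and the effect of the angle, which is controlled by the Lipschitz constant.\<close>

lemma prufer_rhs_diff:
  "prufer_rhs mu x y - prufer_rhs lam x z
    = (mu - lam) * w x * (sin y)\<^sup>2 + (prufer_rhs lam x y - prufer_rhs lam x z)"
  by (simp add: prufer_rhs_def algebra_simps)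

lemma prufer_mono:
  assumes "lam \<le> mu" "x \<in> {a..b}"
  shows "prufer \<alpha> lam x \<le> prufer \<alpha> mu x"
proof -
  obtain K where K: "\<And>x. x \<in> {a..b} \<Longrightarrow> 1 / p x + \<bar>q x\<bar> + \<bar>lam\<bar> * w x \<le> K"
    using coefficient_bound[of "\<bar>lam\<bar>"] by (metis order_refl)
  have "0 \<le> prufer \<alpha> mu x - prufer \<alpha> lam x"
  proof (rule nonneg_if_derivative_bounded_below[where K = K and a = a and b = b
        and d = "\<lambda>x. prufer \<alpha> mu x - prufer \<alpha> lam x"])
    fix x assume x': "x \<in> {a<..<b}"
    then have x: "x \<in> {a..b}" by auto
    show "((\<lambda>x. prufer \<alpha> mu x - prufer \<alpha> lam x) has_real_derivative
        prufer_rhs mu x (prufer \<alpha> mu x) - prufer_rhs lam x (prufer \<alpha> lam x)) (at x)"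
      by (intro DERIV_diff prufer_deriv_at x')
    have "0 \<le> (mu - lam) * w x * (sin (prufer \<alpha> mu x))\<^sup>2"
      using assms w_pos[OF x] by simp
    then show "- K * \<bar>prufer \<alpha> mu x - prufer \<alpha> lam x\<bar>
        \<le> prufer_rhs mu x (prufer \<alpha> mu x) - prufer_rhs lam x (prufer \<alpha> lam x)"
      unfolding prufer_rhs_diff[of mu _ _ lam]
      using prufer_rhs_lipschitz[OF K[OF x] x, of "prufer \<alpha> mu x" "prufer \<alpha> lam x"] by simp
  qed (use assms in \<open>auto simp: prufer_init intro!: continuous_intros prufer_continuous\<close>)
  then show ?thesis by simp
qed

text \<open>The difference of the angles for \<open>lam < mu\<close>, weighted by \<open>exp (K x)\<close>, is non-negative and
  non-decreasing. If it vanished at \<open>b\<close>, the two angles would agree on \<open>(a, b)\<close>, and comparing their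
  equations would give \<open>sin \<theta> = 0\<close> there. But \<open>\<theta>' = 1 / p > 0\<close> wherever \<open>sin \<theta> = 0\<close>.\<close>

lemma prufer_strict_mono: "strict_mono (\<lambda>lam. prufer \<alpha> lam b)"
proof (rule strict_monoI, rule ccontr)
  fix lam mu :: real assume less: "lam < mu" and "\<not> prufer \<alpha> lam b < prufer \<alpha> mu b"
  then have eq_b: "prufer \<alpha> lam b = prufer \<alpha> mu b"
    using prufer_mono[of lam mu b \<alpha>] ab by auto
  obtain K where K: "\<And>x. x \<in> {a..b} \<Longrightarrow> 1 / p x + \<bar>q x\<bar> + \<bar>lam\<bar> * w x \<le> K"
    using coefficient_bound[of "\<bar>lam\<bar>"] by (metis order_refl)
  let ?d = "\<lambda>x. prufer \<alpha> mu x - prufer \<alpha> lam x"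
  have eq: "prufer \<alpha> mu x = prufer \<alpha> lam x" if x: "x \<in> {a<..<b}" for x
  proof -
    have "?d x * exp (K * x) \<le> ?d b * exp (K * b)"
    proof (rule DERIV_nonneg_imp_increasing_open[of x b])
      fix y assume "x < y" "y < b"
      then have y: "y \<in> {a<..<b}" "y \<in> {a..b}" using x by auto
      have "0 \<le> (mu - lam) * w y * (sin (prufer \<alpha> mu y))\<^sup>2"
        using less w_pos[OF y(2)] by simp
      then have "0 \<le> prufer_rhs mu y (prufer \<alpha> mu y) - prufer_rhs lam y (prufer \<alpha> lam y) + K * ?d y"
        unfolding prufer_rhs_diff[of mu _ _ lam]
        using prufer_rhs_lipschitz[OF K[OF y(2)] y(2), of "prufer \<alpha> mu y" "prufer \<alpha> lam y"]
          prufer_mono[of lam mu y \<alpha>] less y(2) by simp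
      moreover have "((\<lambda>x. ?d x * exp (K * x)) has_real_derivative
          (prufer_rhs mu y (prufer \<alpha> mu y) - prufer_rhs lam y (prufer \<alpha> lam y) + K * ?d y)
          * exp (K * y)) (at y)"
        by (auto intro!: derivative_eq_intros prufer_deriv_at y simp: algebra_simps)
      ultimately show "\<exists>e. ((\<lambda>x. ?d x * exp (K * x)) has_real_derivative e) (at y) \<and> 0 \<le> e"
        using zero_le_mult_iff exp_ge_zero by blast
    qed (use x in \<open>auto intro!: continuous_intros continuous_on_subset[OF prufer_continuous]\<close>)
    then have "?d x \<le> 0" by (simp add: eq_b mult_le_0_iff)
    then show ?thesis using prufer_mono[of lam mu x \<alpha>] less x by simp
  qed
  have sin0: "sin (prufer \<alpha> mu x) = 0" if x: "x \<in> {a<..<b}" for x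
  proof -
    have "(?d has_real_derivative
        prufer_rhs mu x (prufer \<alpha> mu x) - prufer_rhs lam x (prufer \<alpha> lam x)) (at x)"
      by (intro DERIV_diff prufer_deriv_at x)
    moreover have "(?d has_real_derivative 0) (at x)"
      by (rule has_field_derivative_transform_within_open[OF DERIV_const[of 0] open_greaterThanLessThan x])
        (simp add: eq)
    ultimately have "prufer_rhs mu x (prufer \<alpha> mu x) - prufer_rhs lam x (prufer \<alpha> lam x) = 0"
      by (rule DERIV_unique)
    then show ?thesis using eq[OF x] w_pos[of x] x less
      by (auto simp: prufer_rhs_def algebra_simps)
  qed
  define x where "x = (a + b) / 2"
  have x: "x \<in> {a<..<b}" using ab by (simp add: x_def)
  have "((\<lambda>y. sin (prufer \<alpha> mu y)) has_real_derivative
      cos (prufer \<alpha> mu x) * prufer_rhs mu x (prufer \<alpha> mu x)) (at x)"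
    by (auto intro!: derivative_eq_intros prufer_deriv_at x)
  moreover have "((\<lambda>y. sin (prufer \<alpha> mu y)) has_real_derivative 0) (at x)"
    by (rule has_field_derivative_transform_within_open[OF DERIV_const[of 0] open_greaterThanLessThan x])
      (simp add: sin0)
  ultimately have "cos (prufer \<alpha> mu x) * prufer_rhs mu x (prufer \<alpha> mu x) = 0"
    by (rule DERIV_unique)
  moreover have "cos (prufer \<alpha> mu x) \<noteq> 0" using sin0[OF x] sin_zero_abs_cos_one by fastforce
  moreover have "0 < p x" using p_pos x by simp
  ultimately show False using sin0[OF x] by (simp add: prufer_rhs_def)
qed

text \<open>For \<open>lam \<le> mu\<close> the difference \<open>d\<close> of the angles satisfies \<open>d' \<le> K d + (mu - lam) W\<close>, where \<open>K\<close> can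
  be chosen uniformly on bounded sets of parameters. So \<open>\<theta>(b)\<close> is locally Lipschitz in the parameter.\<close>

lemma prufer_continuous_parameter: "continuous_on UNIV (\<lambda>lam. prufer \<alpha> lam b)"
proof -
  have lip: "\<exists>L. \<forall>lam mu. \<bar>lam\<bar> \<le> N \<and> \<bar>mu\<bar> \<le> N \<and> lam \<le> mu \<longrightarrow>
      prufer \<alpha> mu b - prufer \<alpha> lam b \<le> L * (mu - lam)" for N
  proof -
    obtain K where K: "0 \<le> K"
      "\<And>lam x. \<bar>lam\<bar> \<le> N \<Longrightarrow> x \<in> {a..b} \<Longrightarrow> 1 / p x + \<bar>q x\<bar> + \<bar>lam\<bar> * w x \<le> K"
      using coefficient_bound[of N] by metis
    obtain W where "0 \<le> W" and W1: "\<And>lam x. \<bar>lam\<bar> \<le> 1 \<Longrightarrow> x \<in> {a..b} \<Longrightarrow> 1 / p x + \<bar>q x\<bar> + \<bar>lam\<bar> * w x \<le> W"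
      using coefficient_bound[of 1] by metis
    from W1[of 1] have W: "\<And>x. x \<in> {a..b} \<Longrightarrow> 1 / p x + \<bar>q x\<bar> + w x \<le> W" by simp
    have wW: "0 < w x" "w x \<le> W" if "x \<in> {a..b}" for x
    proof -
      have "0 < 1 / p x" using p_pos[OF that] by simp
      then show "0 < w x" "w x \<le> W" using W[OF that] w_pos[OF that] by linarith+
    qed
    have "prufer \<alpha> mu b - prufer \<alpha> lam b \<le> W * (b - a) * exp (K * (b - a)) * (mu - lam)"
      if "\<bar>lam\<bar> \<le> N" "\<bar>mu\<bar> \<le> N" "lam \<le> mu" for lam mu
    proof -
      let ?d = "\<lambda>x. prufer \<alpha> mu x - prufer \<alpha> lam x"
      let ?g = "\<lambda>x. ?d x * exp (- K * (x - a)) - (mu - lam) * W * x"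
      have "?g b \<le> ?g a"
      proof (rule DERIV_nonpos_imp_decreasing_open[where f = ?g and a = a and b = b])
        fix y assume "a < y" "y < b"
        then have y: "y \<in> {a<..<b}" "y \<in> {a..b}" by auto
        let ?r = "prufer_rhs mu y (prufer \<alpha> mu y) - prufer_rhs lam y (prufer \<alpha> lam y)"
        have "(mu - lam) * w y * (sin (prufer \<alpha> mu y))\<^sup>2 \<le> (mu - lam) * W * 1"
          using that wW[OF y(2)] by (intro mult_mono) (auto simp: abs_square_le_1)
        then have "?r - K * ?d y \<le> (mu - lam) * W"
          unfolding prufer_rhs_diff[of mu _ _ lam]
          using prufer_rhs_lipschitz[OF K(2)[OF that(1) y(2)] y(2), of "prufer \<alpha> mu y" "prufer \<alpha> lam y"]
            prufer_mono[of lam mu y \<alpha>] that y(2) by simp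
        then have "(?r - K * ?d y) * exp (- K * (y - a)) \<le> (mu - lam) * W * exp (- K * (y - a))"
          by (rule mult_right_mono) simp
        also have "\<dots> \<le> (mu - lam) * W * 1"
          using K(1) that wW[OF y(2)] y by (intro mult_left_mono) auto
        finally have "(?r - K * ?d y) * exp (- K * (y - a)) - (mu - lam) * W \<le> 0" by simp
        moreover have "(?g has_real_derivative
            (?r - K * ?d y) * exp (- K * (y - a)) - (mu - lam) * W) (at y)"
          by (auto intro!: derivative_eq_intros prufer_deriv_at y simp: algebra_simps)
        ultimately show "\<exists>e. (?g has_real_derivative e) (at y) \<and> e \<le> 0" by blast
      qed (use ab in \<open>auto intro!: continuous_intros prufer_continuous\<close>)
      then have "?d b * exp (- K * (b - a)) \<le> (mu - lam) * W * (b - a)"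
        by (simp add: prufer_init algebra_simps)
      then have "?d b * exp (- K * (b - a)) * exp (K * (b - a))
          \<le> (mu - lam) * W * (b - a) * exp (K * (b - a))"
        by (rule mult_right_mono) simp
      then show ?thesis by (simp add: mult.assoc exp_add[symmetric]) (simp add: mult_ac)
    qed
    then show ?thesis by blast
  qed
  have "continuous_on {-N..N} (\<lambda>lam. prufer \<alpha> lam b)" for N
  proof -
    obtain L where L: "\<And>lam mu. \<bar>lam\<bar> \<le> N \<Longrightarrow> \<bar>mu\<bar> \<le> N \<Longrightarrow> lam \<le> mu \<Longrightarrow>
      prufer \<alpha> mu b - prufer \<alpha> lam b \<le> L * (mu - lam)"
      using lip[of N] by blast
    have "dist (prufer \<alpha> x b) (prufer \<alpha> y b) \<le> \<bar>L\<bar> * dist x y"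
      if "x \<in> {-N..N}" "y \<in> {-N..N}" for x y
    proof -
      have *: "\<bar>prufer \<alpha> v b - prufer \<alpha> u b\<bar> \<le> \<bar>L\<bar> * \<bar>v - u\<bar>"
        if "u \<in> {-N..N}" "v \<in> {-N..N}" "u \<le> v" for u v
      proof -
        have "\<bar>prufer \<alpha> v b - prufer \<alpha> u b\<bar> \<le> L * (v - u)"
          using L[of u v] that prufer_mono[of u v b \<alpha>] ab by auto
        also have "\<dots> \<le> \<bar>L\<bar> * \<bar>v - u\<bar>" by (metis abs_ge_self abs_mult)
        finally show ?thesis .
      qed
      show ?thesis
        using *[of x y] *[of y x] that by (cases "x \<le> y") (auto simp: dist_real_def abs_minus_commute)
    qed
    then have "\<bar>L\<bar>-lipschitz_on {-N..N} (\<lambda>lam. prufer \<alpha> lam b)" by (intro lipschitz_onI) auto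
    then show ?thesis by (rule lipschitz_on_continuous_on)
  qed
  then have "isCont (\<lambda>lam. prufer \<alpha> lam b) x" for x
    by (rule continuous_on_interior[where S = "{- (\<bar>x\<bar> + 1)..\<bar>x\<bar> + 1}"]) auto
  then show ?thesis by (simp add: continuous_on_eq_continuous_at)
qed

end

section \<open>Growth of the Pruefer angle in the spectral parameter\<close>

lemma cos_sq_plus_mult_sin_sq_pos:
  fixes r x :: real
  assumes "0 < r"
  shows "0 < (cos x)\<^sup>2 + r * (sin x)\<^sup>2"
proof (cases "sin x = 0")
  case True
  then show ?thesis using sin_cos_squared_add[of x] by simp
qed (use assms in \<open>auto intro: add_nonneg_pos\<close>)

text \<open>The angle \<open>\<phi>\<close> with \<open>tan \<phi> = S tan \<theta>\<close> that agrees with \<open>\<theta>\<close> at multiples of \<open>\<pi> / 2\<close> is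
  \<open>\<theta>\<close> plus the arctangent below, by the addition theorem for \<open>tan (\<phi> - \<theta>)\<close>. In this form it is
  smooth also where \<open>tan \<theta>\<close> is not, and it stays within \<open>\<pi> / 2\<close> of \<open>\<theta>\<close>.\<close>

lemma rescaled_angle_derivative:
  fixes \<theta> S :: "real \<Rightarrow> real"
  assumes \<theta>: "(\<theta> has_real_derivative \<theta>') (at x)"
    and S: "(S has_real_derivative S') (at x)" and pos: "0 < S x"
  shows "((\<lambda>x. \<theta> x + arctan ((S x - 1) * sin (\<theta> x) * cos (\<theta> x)
        / ((cos (\<theta> x))\<^sup>2 + S x * (sin (\<theta> x))\<^sup>2))) has_real_derivative
      (S x * \<theta>' + S' * sin (\<theta> x) * cos (\<theta> x)) / ((cos (\<theta> x))\<^sup>2 + (S x)\<^sup>2 * (sin (\<theta> x))\<^sup>2)) (at x)"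
proof -
  define s where "s = sin (\<theta> x)"
  define c where "c = cos (\<theta> x)"
  define r where "r = S x"
  have sc: "s\<^sup>2 + c\<^sup>2 = 1" by (simp add: s_def c_def)
  have r: "0 < r" using pos by (simp add: r_def)
  let ?N = "(r - 1) * s * c" and ?D = "c\<^sup>2 + r * s\<^sup>2" and ?Q = "c\<^sup>2 + r\<^sup>2 * s\<^sup>2"
  let ?N' = "S' * s * c + (r - 1) * (c\<^sup>2 - s\<^sup>2) * \<theta>'" and ?D' = "S' * s\<^sup>2 + 2 * (r - 1) * s * c * \<theta>'"
  have D: "0 < ?D" and Q: "0 < ?Q"
    using cos_sq_plus_mult_sin_sq_pos r by (auto simp: s_def c_def)
  \<comment> \<open>the identity that collapses the derivative of the arctangent\<close>
  have DQ: "?D\<^sup>2 + ?N\<^sup>2 = ?Q" using sc by Groebner_Basis.algebra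
  have num: "?Q * \<theta>' + (?N' * ?D - ?N * ?D') = r * \<theta>' + S' * s * c" using sc by Groebner_Basis.algebra
  have "((\<lambda>x. ((S x - 1) * sin (\<theta> x) * cos (\<theta> x)) / ((cos (\<theta> x))\<^sup>2 + S x * (sin (\<theta> x))\<^sup>2))
      has_real_derivative (?N' * ((cos (\<theta> x))\<^sup>2 + S x * (sin (\<theta> x))\<^sup>2)
        - ((S x - 1) * sin (\<theta> x) * cos (\<theta> x)) * ?D')
        / (((cos (\<theta> x))\<^sup>2 + S x * (sin (\<theta> x))\<^sup>2) * ((cos (\<theta> x))\<^sup>2 + S x * (sin (\<theta> x))\<^sup>2))) (at x)"
  proof (rule DERIV_divide)
    show "((\<lambda>x. (S x - 1) * sin (\<theta> x) * cos (\<theta> x)) has_real_derivative ?N') (at x)"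
      by (auto intro!: derivative_eq_intros \<theta> S
          simp: s_def c_def r_def power2_eq_square algebra_simps)
    show "((\<lambda>x. (cos (\<theta> x))\<^sup>2 + S x * (sin (\<theta> x))\<^sup>2) has_real_derivative ?D') (at x)"
      by (auto intro!: derivative_eq_intros \<theta> S
          simp: s_def c_def r_def power2_eq_square algebra_simps)
    show "(cos (\<theta> x))\<^sup>2 + S x * (sin (\<theta> x))\<^sup>2 \<noteq> 0"
      using D by (simp add: s_def c_def r_def)
  qed
  note DERIV_add[OF \<theta> DERIV_chain2[OF DERIV_arctan this], folded s_def c_def r_def]
  moreover have "\<theta>' + inverse (1 + (?N / ?D)\<^sup>2) * ((?N' * ?D - ?N * ?D') / (?D * ?D))
      = (r * \<theta>' + S' * s * c) / ?Q"
  proof -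
    have "1 + (?N / ?D)\<^sup>2 = ?Q / (?D * ?D)"
      using D unfolding DQ[symmetric] by (simp add: power_divide power2_eq_square add_divide_distrib)
    then have "inverse (1 + (?N / ?D)\<^sup>2) * ((?N' * ?D - ?N * ?D') / (?D * ?D))
        = (?N' * ?D - ?N * ?D') / ?Q"
      using D Q by simp
    moreover have "\<theta>' + (?N' * ?D - ?N * ?D') / ?Q = (?Q * \<theta>' + (?N' * ?D - ?N * ?D')) / ?Q"
      using Q by (simp add: add_divide_distrib)
    ultimately show ?thesis unfolding num by simp
  qed
  ultimately show ?thesis by (simp add: s_def c_def r_def)
qed

context sturm_liouville
begin

text \<open>With \<open>S = sqrt (lam p w)\<close> the two leading coefficients \<open>S / p\<close> and \<open>lam w / S\<close> of the equation for
  the rescaled angle coincide: its derivative is \<open>sqrt lam sqrt (w / p)\<close> plus a remainder that is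
  bounded uniformly in \<open>lam \<ge> 1\<close>. Integration gives the claim, as rescaling moves the angle by at
  most \<open>\<pi> / 2\<close> at each end point.\<close>

lemma prufer_asymptotics:
  assumes pw': "\<And>x. x \<in> {a..b} \<Longrightarrow>
      ((\<lambda>x. p x * w x) has_real_derivative m x) (at x within {a..b})"
    and m: "continuous_on {a..b} m"
  obtains C where "\<And>lam. 1 \<le> lam \<Longrightarrow>
    \<bar>prufer \<alpha> lam b - integral {a..b} (\<lambda>x. sqrt (w x / p x)) * sqrt lam\<bar> \<le> C"
proof -
  have pw: "0 < p x * w x" if "x \<in> {a..b}" for x using p_pos w_pos that by simp
  let ?E = "\<lambda>x. \<bar>m x\<bar> / (4 * (p x * w x)) + \<bar>q x\<bar> / sqrt (p x * w x)"
  have "continuous_on {a..b} ?E"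
    by (intro continuous_intros m cont) (use pw in force)+
  then have "bounded (?E ` {a..b})"
    by (intro compact_imp_bounded compact_continuous_image) auto
  then obtain C where "\<And>x. x \<in> {a..b} \<Longrightarrow> \<bar>?E x\<bar> \<le> C"
    unfolding bounded_iff ball_simps real_norm_def by blast
  then have C: "\<And>x. x \<in> {a..b} \<Longrightarrow> ?E x \<le> C" by (meson abs_le_D1)
  have contR: "continuous_on {a..b} (\<lambda>x. sqrt (w x / p x))"
    by (intro continuous_intros cont) (use p_pos in force)
  let ?B = "integral {a..b} (\<lambda>x. sqrt (w x / p x))"
  have "\<bar>prufer \<alpha> lam b - ?B * sqrt lam\<bar> \<le> C * (b - a) + pi + \<bar>\<alpha>\<bar>" if lam: "1 \<le> lam" for lam
  proof -
    define \<theta> where "\<theta> = prufer \<alpha> lam"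
    define S where "S = (\<lambda>x. sqrt lam * sqrt (p x * w x))"
    define A where "A = (\<lambda>x. arctan ((S x - 1) * sin (\<theta> x) * cos (\<theta> x)
        / ((cos (\<theta> x))\<^sup>2 + S x * (sin (\<theta> x))\<^sup>2)))"
    define h where "h = (\<lambda>x. \<theta> x + A x - sqrt lam * integral {a..x} (\<lambda>x. sqrt (w x / p x)))"
    have S_pos: "0 < S x" if "x \<in> {a..b}" for x using pw[OF that] lam by (simp add: S_def)
    have S_cont: "continuous_on {a..b} S" unfolding S_def by (intro continuous_intros cont)
    have \<theta>_cont: "continuous_on {a..b} \<theta>" unfolding \<theta>_def by (rule prufer_continuous)
    have h_cont: "continuous_on {a..b} h" unfolding h_def A_def
      by (intro continuous_intros S_cont \<theta>_cont indefinite_integral_continuous_1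
          integrable_continuous_real contR)
        (metis S_pos cos_sq_plus_mult_sin_sq_pos less_irrefl)
    have h_deriv: "\<exists>D. (h has_real_derivative D) (at x) \<and> \<bar>D\<bar> \<le> C" if x': "x \<in> {a<..<b}" for x
    proof -
      have x: "x \<in> {a..b}" using x' by auto
      have at: "at x within {a..b} = at x" using x' by (intro at_within_Icc_at) auto
      define s where "s = sin (\<theta> x)"
      define c where "c = cos (\<theta> x)"
      define r where "r = S x"
      define S' where "S' = sqrt lam * (m x * (inverse (sqrt (p x * w x)) / 2))"
      let ?Q = "c\<^sup>2 + r\<^sup>2 * s\<^sup>2"
      have r: "0 < r" using S_pos[OF x] by (simp add: r_def)
      have Q: "0 < ?Q"
        unfolding s_def c_def using r by (intro cos_sq_plus_mult_sin_sq_pos) simp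
      have S_deriv: "(S has_real_derivative S') (at x)"
        unfolding S_def S'_def
        using DERIV_cmult[OF DERIV_chain2[OF DERIV_real_sqrt[OF pw[OF x]] pw'[OF x, unfolded at]], of "sqrt lam"]
        by (simp add: mult_ac)
      have \<theta>_deriv: "(\<theta> has_real_derivative prufer_rhs lam x (\<theta> x)) (at x)"
        unfolding \<theta>_def by (rule prufer_deriv_at[OF x'])
      have R_deriv: "((\<lambda>x. integral {a..x} (\<lambda>x. sqrt (w x / p x)))
          has_real_derivative sqrt (w x / p x)) (at x)"
        using integral_has_real_derivative[OF contR x] by (simp add: at)
      let ?D = "(r * prufer_rhs lam x (\<theta> x) + S' * s * c) / ?Q - sqrt lam * sqrt (w x / p x)"
      have "(h has_real_derivative ?D) (at x)"
        unfolding h_def A_def s_def c_def r_def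
        by (intro DERIV_diff rescaled_angle_derivative \<theta>_deriv S_deriv S_pos[OF x] DERIV_cmult R_deriv)
      \<comment> \<open>the leading terms cancel and only the uniformly bounded remainder is left\<close>
      moreover have "?D = (S' * s * c - r * q x * s\<^sup>2) / ?Q"
      proof -
        have r2: "lam * w x = r\<^sup>2 / p x"
          using pw[OF x] p_pos[OF x] lam by (simp add: r_def S_def power_mult_distrib)
        have "r * prufer_rhs lam x (\<theta> x) = r * c\<^sup>2 / p x + r * (r\<^sup>2 / p x) * s\<^sup>2 - r * q x * s\<^sup>2"
          unfolding prufer_rhs_def r2 s_def c_def by (simp add: algebra_simps)
        also have "\<dots> = r / p x * ?Q - r * q x * s\<^sup>2"
          by (simp add: algebra_simps)
        also have "r / p x = sqrt lam * sqrt (w x / p x)"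
          using p_pos[OF x] w_pos[OF x]
          by (simp add: r_def S_def real_sqrt_mult real_sqrt_divide field_simps)
        finally have "r * prufer_rhs lam x (\<theta> x) + S' * s * c
            = sqrt lam * sqrt (w x / p x) * ?Q + (S' * s * c - r * q x * s\<^sup>2)" by simp
        moreover have "(X * Z + Y) / Z - X = Y / Z" if "0 < Z" for X Y Z :: real
          using that by (simp add: field_simps)
        ultimately show ?thesis using Q by metis
      qed
      moreover have "\<bar>(S' * s * c - r * q x * s\<^sup>2) / ?Q\<bar> \<le> C"
      proof -
        have "\<bar>S' * s * c\<bar> \<le> \<bar>S'\<bar> / (2 * r) * ?Q"
        proof -
          \<comment> \<open>arithmetic-geometric mean inequality for \<open>c\<^sup>2\<close> and \<open>r\<^sup>2 s\<^sup>2\<close>\<close>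
          have "0 \<le> (\<bar>c\<bar> - r * \<bar>s\<bar>)\<^sup>2" by simp
          then have "2 * r * (\<bar>s\<bar> * \<bar>c\<bar>) \<le> ?Q" by (simp add: power2_diff power_mult_distrib algebra_simps)
          then have "\<bar>s\<bar> * \<bar>c\<bar> \<le> ?Q / (2 * r)" using r by (simp add: field_simps)
          from mult_left_mono[OF this, of "\<bar>S'\<bar>"] show ?thesis by (simp add: abs_mult mult_ac)
        qed
        moreover have "\<bar>r * q x * s\<^sup>2\<bar> \<le> \<bar>q x\<bar> / r * ?Q"
        proof -
          have "\<bar>r * q x * s\<^sup>2\<bar> = \<bar>q x\<bar> / r * (r\<^sup>2 * s\<^sup>2)"
            using r by (simp add: abs_mult power2_eq_square)
          also have "\<dots> \<le> \<bar>q x\<bar> / r * ?Q" using r by (intro mult_left_mono) auto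
          finally show ?thesis .
        qed
        ultimately have "\<bar>S' * s * c - r * q x * s\<^sup>2\<bar> \<le> (\<bar>S'\<bar> / (2 * r) + \<bar>q x\<bar> / r) * ?Q"
          by (simp add: distrib_right)
        then have "\<bar>(S' * s * c - r * q x * s\<^sup>2) / ?Q\<bar> \<le> \<bar>S'\<bar> / (2 * r) + \<bar>q x\<bar> / r"
          using Q by (simp add: abs_divide pos_divide_le_eq)
        also have "\<bar>S'\<bar> / (2 * r) = \<bar>m x\<bar> / (4 * (p x * w x))"
          using p_pos[OF x] w_pos[OF x] lam by (simp add: S'_def r_def S_def abs_mult field_simps)
        also have "\<bar>q x\<bar> / r \<le> \<bar>q x\<bar> / sqrt (p x * w x)"
        proof (intro divide_left_mono)
          show "sqrt (p x * w x) \<le> r"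
            using lam pw[OF x] mult_right_mono[of 1 "sqrt lam" "sqrt (p x * w x)"] by (simp add: r_def S_def)
        qed (use r pw[OF x] in auto)
        also have "\<bar>m x\<bar> / (4 * (p x * w x)) + \<bar>q x\<bar> / sqrt (p x * w x) \<le> C" by (rule C[OF x])
        finally show ?thesis by simp
      qed
      ultimately show ?thesis by metis
    qed
    obtain z where z: "a < z" "z < b" "\<exists>D. (h has_real_derivative D) (at z) \<and> \<bar>D\<bar> \<le> C
        \<and> h b - h a = (b - a) * D"
    proof -
      have "\<And>x. a < x \<Longrightarrow> x < b \<Longrightarrow> h differentiable (at x)"
        using h_deriv unfolding real_differentiable_def by (meson greaterThanLessThan_iff)
      from MVT[OF ab h_cont this] obtain l z where "a < z" "z < b" "DERIV h z :> l"
        "h b - h a = (b - a) * l" by blast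
      moreover from this h_deriv[of z] have "\<bar>l\<bar> \<le> C"
        by (auto dest: DERIV_unique)
      ultimately show ?thesis using that by blast
    qed
    then have "\<bar>h b - h a\<bar> \<le> C * (b - a)"
      using ab by (auto simp: abs_mult mult.commute intro!: mult_right_mono)
    moreover have "\<bar>A x\<bar> \<le> pi / 2" for x
    proof -
      have "\<bar>arctan y\<bar> \<le> pi / 2" for y
        using arctan_lbound[of y] arctan_ubound[of y] by linarith
      then show ?thesis unfolding A_def .
    qed
    from this[of a] this[of b] have "\<bar>A b - A a\<bar> \<le> pi" by linarith
    ultimately show ?thesis
      by (simp add: h_def \<theta>_def prufer_init mult.commute)
  qed
  then show ?thesis by (rule that)
qed

end

lemma the_kth_of_strict_mono_range:
  fixes e :: "nat \<Rightarrow> real"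
  assumes "strict_mono e"
  shows "(THE x. x \<in> range e \<and> finite {y \<in> range e. y < x} \<and> card {y \<in> range e. y < x} = k) = e k"
proof -
  have below: "{y \<in> range e. y < e j} = e ` {..<j}" for j
    using assms by (auto simp: strict_mono_less)
  have card: "card (e ` {..<j}) = j" for j
    by (simp add: card_image inj_on_subset[OF strict_mono_imp_inj_on[OF assms] subset_UNIV])
  show ?thesis
    by (rule the_equality) (auto simp: below card)
qed

text \<open>The levels \<open>\<beta> + j \<pi>\<close> attained by \<open>\<Theta>\<close> are bounded below and, since \<open>\<Theta>\<close> is continuous and
  unbounded above, upward closed. So from the least one on each of them is attained exactly once, and
  the \<open>k\<close>-th solution satisfies \<open>B sqrt x = k \<pi> + O(1)\<close>.\<close>

lemma angle_level_set_asymptotics: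
  fixes \<Theta> :: "real \<Rightarrow> real"
  assumes cont: "continuous_on UNIV \<Theta>" and mono: "strict_mono \<Theta>" and nonneg: "\<And>x. 0 \<le> \<Theta> x"
    and asymp: "\<And>x. 1 \<le> x \<Longrightarrow> \<bar>\<Theta> x - B * sqrt x\<bar> \<le> C" and B: "0 < B"
    and E: "E = {x. sin (\<Theta> x - \<beta>) = 0}"
  shows "(\<lambda>k. (THE x. x \<in> E \<and> finite {y\<in>E. y < x} \<and> card {y\<in>E. y < x} = k - 1) / (real k)\<^sup>2)
    \<longlonglongrightarrow> pi\<^sup>2 / B\<^sup>2"
proof -
  have unbounded: "\<exists>x. y \<le> \<Theta> x" for y
  proof -
    define x where "x = max 1 (((\<bar>y\<bar> + C) / B)\<^sup>2)"
    have "\<bar>(\<bar>y\<bar> + C) / B\<bar> \<le> sqrt x" unfolding x_def by (metis max.cobounded2 real_le_rsqrt real_sqrt_abs real_sqrt_le_iff)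
    then have "(\<bar>y\<bar> + C) / B \<le> sqrt x" by linarith
    then have "\<bar>y\<bar> + C \<le> B * sqrt x" using B by (simp add: field_simps)
    moreover have "\<bar>\<Theta> x - B * sqrt x\<bar> \<le> C" by (rule asymp) (simp add: x_def)
    ultimately show ?thesis by (intro exI[of _ x]) linarith
  qed
  have up: "\<exists>x'. \<Theta> x' = z" if "\<Theta> x \<le> z" for x z
  proof -
    obtain y where y: "z \<le> \<Theta> y" using unbounded by blast
    have "x \<le> y" using that y mono by (metis order_trans strict_mono_less_eq)
    from IVT'[OF that y this] continuous_on_subset[OF cont] show ?thesis by blast
  qed
  \<comment> \<open>shifting to a base level \<open>\<gamma> \<le> 0\<close> makes natural numbers enough to index the attained levels\<close>
  define \<gamma> where "\<gamma> = \<beta> - of_int \<lceil>\<beta> / pi\<rceil> * pi"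
  have "\<gamma> \<le> 0"
  proof -
    have "\<beta> / pi * pi \<le> of_int \<lceil>\<beta> / pi\<rceil> * pi" by (intro mult_right_mono le_of_int_ceiling) simp
    then show ?thesis by (simp add: \<gamma>_def)
  qed
  have mem_E: "x \<in> E \<longleftrightarrow> (\<exists>n::nat. \<Theta> x = \<gamma> + real n * pi)" for x
  proof
    assume "x \<in> E"
    then obtain i :: int where i: "\<Theta> x - \<beta> = of_int i * pi" by (auto simp: E sin_zero_iff_int2)
    let ?j = "i + \<lceil>\<beta> / pi\<rceil>"
    have eq: "\<Theta> x = \<gamma> + of_int ?j * pi" using i by (simp add: \<gamma>_def algebra_simps)
    then have "0 \<le> of_int ?j * pi" using nonneg[of x] \<open>\<gamma> \<le> 0\<close> by linarith
    then have "0 \<le> real_of_int ?j" using pi_gt_zero by (metis zero_le_mult_iff not_less)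
    then have "0 \<le> ?j" by linarith
    then have "of_int ?j = real (nat ?j)" by simp
    then show "\<exists>n::nat. \<Theta> x = \<gamma> + real n * pi" using eq by metis
  next
    assume "\<exists>n::nat. \<Theta> x = \<gamma> + real n * pi"
    then obtain n :: nat where "\<Theta> x - \<beta> = of_int (int n - \<lceil>\<beta> / pi\<rceil>) * pi"
      by (auto simp: \<gamma>_def algebra_simps)
    then show "x \<in> E" unfolding E sin_zero_iff_int2 by blast
  qed
  define n0 where "n0 = (LEAST n. \<exists>x. \<Theta> x = \<gamma> + real n * pi)"
  have "\<exists>n::nat. \<exists>x. \<Theta> x = \<gamma> + real n * pi"
  proof -
    obtain n :: nat where "(\<Theta> 0 - \<gamma>) / pi \<le> real n" using real_arch_simple by blast
    then have "\<Theta> 0 \<le> \<gamma> + real n * pi" by (simp add: field_simps)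
    then show ?thesis using up by blast
  qed
  then have n0: "\<exists>x. \<Theta> x = \<gamma> + real n0 * pi" unfolding n0_def by (rule LeastI_ex)
  have n0_le: "n0 \<le> n" if "\<Theta> x = \<gamma> + real n * pi" for x n
    unfolding n0_def by (rule Least_le) (use that in blast)
  have "\<exists>x. \<Theta> x = \<gamma> + real (n0 + k) * pi" for k
  proof -
    obtain x where "\<Theta> x = \<gamma> + real n0 * pi" using n0 by blast
    also have "\<dots> \<le> \<gamma> + real (n0 + k) * pi" by (intro add_left_mono mult_right_mono) auto
    finally show ?thesis by (rule up)
  qed
  then obtain e where e: "\<And>k. \<Theta> (e k) = \<gamma> + real (n0 + k) * pi" by metis
  have e_mono: "strict_mono e"
  proof (rule strict_monoI)
    fix i j :: nat assume "i < j"
    then have "\<Theta> (e i) < \<Theta> (e j)" unfolding e by (simp add: mult_strict_right_mono)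
    then show "e i < e j" using mono by (simp add: strict_mono_less)
  qed
  have E_range: "E = range e"
  proof (intro Set.set_eqI iffI)
    fix x assume "x \<in> E"
    then obtain n where n: "\<Theta> x = \<gamma> + real n * pi" unfolding mem_E by blast
    then have "\<Theta> x = \<Theta> (e (n - n0))" using n0_le[OF n] by (simp add: e)
    then have "x = e (n - n0)" using strict_mono_eq[OF mono] by blast
    then show "x \<in> range e" by blast
  qed (use e mem_E in blast)
  have kth: "(THE x. x \<in> E \<and> finite {y\<in>E. y < x} \<and> card {y\<in>E. y < x} = k - 1) = e (k - 1)" for k
    unfolding E_range by (rule the_kth_of_strict_mono_range[OF e_mono])
  define C' where "C' = \<bar>C\<bar> + \<bar>\<gamma>\<bar> + real n0 * pi + pi"
  have "\<forall>\<^sub>F k in sequentially. norm (sqrt (e (k - 1)) / real k - pi / B) \<le> C' / B * inverse (real k)"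
  proof -
    obtain N :: nat where N: "(\<Theta> 1 - \<gamma>) / pi \<le> real N" using real_arch_simple by blast
    have "\<forall>\<^sub>F k in sequentially. N + 1 \<le> k" by (rule eventually_ge_at_top)
    then show ?thesis
    proof eventually_elim
      case (elim k)
      have th: "\<Theta> (e (k - 1)) = \<gamma> + real n0 * pi + real k * pi - pi"
        using elim by (simp add: e of_nat_diff algebra_simps)
      have "\<Theta> 1 \<le> \<gamma> + real N * pi" using N by (simp add: field_simps)
      also have "\<dots> \<le> \<gamma> + real (n0 + (k - 1)) * pi"
        using elim by (intro add_left_mono mult_right_mono) auto
      finally have "\<Theta> 1 \<le> \<Theta> (e (k - 1))" unfolding e .
      then have "1 \<le> e (k - 1)" using mono by (simp add: strict_mono_less_eq)
      from asymp[OF this] have "\<bar>B * sqrt (e (k - 1)) - real k * pi\<bar> \<le> C'"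
        unfolding th C'_def
        using pi_gt_zero mult_nonneg_nonneg[of "real n0" pi] by linarith
      then have "\<bar>B * sqrt (e (k - 1)) - real k * pi\<bar> / (B * real k) \<le> C' / (B * real k)"
        using B by (intro divide_right_mono) auto
      moreover have "sqrt (e (k - 1)) / real k - pi / B = (B * sqrt (e (k - 1)) - real k * pi) / (B * real k)"
        using B elim by (simp add: field_simps)
      ultimately show ?case using B by (simp add: abs_divide abs_mult divide_inverse mult_ac)
    qed
  qed
  then have "(\<lambda>k. sqrt (e (k - 1)) / real k - pi / B) \<longlonglongrightarrow> 0"
    by (rule Lim_null_comparison)
      (rule tendsto_mult_right_zero[OF LIMSEQ_inverse_real_of_nat[THEN LIMSEQ_imp_Suc]])
  then have "(\<lambda>k. (sqrt (e (k - 1)) / real k)\<^sup>2) \<longlonglongrightarrow> (pi / B)\<^sup>2"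
    by (intro tendsto_power) (simp add: LIM_zero_iff)
  moreover have "\<forall>\<^sub>F k in sequentially. (sqrt (e (k - 1)) / real k)\<^sup>2 = e (k - 1) / (real k)\<^sup>2"
  proof -
    obtain N :: nat where N: "(\<Theta> 0 - \<gamma>) / pi \<le> real N" using real_arch_simple by blast
    have "\<forall>\<^sub>F k in sequentially. N + 1 \<le> k" by (rule eventually_ge_at_top)
    then show ?thesis
    proof eventually_elim
      case (elim k)
      have "\<Theta> 0 \<le> \<gamma> + real N * pi" using N by (simp add: field_simps)
      also have "\<dots> \<le> \<gamma> + real (n0 + (k - 1)) * pi"
        using elim by (intro add_left_mono mult_right_mono) auto
      finally have "\<Theta> 0 \<le> \<Theta> (e (k - 1))" unfolding e .
      then have "0 \<le> e (k - 1)" using mono by (simp add: strict_mono_less_eq)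
      then show ?case by (simp add: power_divide)
    qed
  qed
  ultimately show ?thesis
    unfolding kth power_divide[symmetric] by (rule Lim_transform_eventually)
qed

section \<open>Eigenvalues as levels of the Pruefer angle, and Weyl's law\<close>

context sturm_liouville
begin

text \<open>Once \<open>\<theta>\<close> is known, the amplitude solves the linear equation
  \<open>v' = (1 / p + q - lam w) sin \<theta> cos \<theta> v\<close>, so it is an exponential.\<close>

lemma prufer_solution:
  obtains u v where "\<And>x. u x = v x * sin (prufer \<alpha> lam x)" "\<And>x. 0 < v x"
    and "\<And>x. x \<in> {a..b} \<Longrightarrow>
      (u has_real_derivative v x * cos (prufer \<alpha> lam x) / p x) (at x within {a..b})"
    and "\<And>x. x \<in> {a..b} \<Longrightarrow> ((\<lambda>x. v x * cos (prufer \<alpha> lam x)) has_real_derivative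
      (q x - lam * w x) * u x) (at x within {a..b})"
proof -
  let ?\<theta> = "prufer \<alpha> lam"
  let ?g = "\<lambda>x. (1 / p x + q x - lam * w x) * (sin (?\<theta> x) * cos (?\<theta> x))"
  define v where "v = (\<lambda>x. exp (integral {a..x} ?g))"
  have g_cont: "continuous_on {a..b} ?g"
    by (intro continuous_intros cont prufer_continuous) (use p_pos in force)
  have v: "(v has_real_derivative v x * ?g x) (at x within {a..b})" if "x \<in> {a..b}" for x
    unfolding v_def
    by (rule DERIV_chain2[OF DERIV_exp integral_has_real_derivative[OF g_cont that]])
  note \<theta> = prufer_deriv[of _ \<alpha> lam]
  show ?thesis
  proof (rule that[of "\<lambda>x. v x * sin (?\<theta> x)" v])
    fix x assume x: "x \<in> {a..b}"
    define s where "s = sin (?\<theta> x)"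
    define c where "c = cos (?\<theta> x)"
    have sc: "s\<^sup>2 + c\<^sup>2 = 1" by (simp add: s_def c_def)
    have p: "p x \<noteq> 0" using p_pos[OF x] by simp
    have "((\<lambda>x. v x * sin (?\<theta> x)) has_real_derivative
        v x * ?g x * s + v x * (c * prufer_rhs lam x (?\<theta> x))) (at x within {a..b})"
      unfolding s_def c_def
      by (rule derivative_eq_intros v[OF x] \<theta>[OF x] refl | simp)+
    moreover have "v x * ?g x * s + v x * (c * prufer_rhs lam x (?\<theta> x))
        = v x * c * (s\<^sup>2 + c\<^sup>2) * (1 / p x)"
      unfolding prufer_rhs_def s_def[symmetric] c_def[symmetric]
      by (simp add: power2_eq_square algebra_simps)
    ultimately show "((\<lambda>x. v x * sin (?\<theta> x)) has_real_derivative
        v x * cos (?\<theta> x) / p x) (at x within {a..b})"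
      by (simp add: sc) (simp add: c_def)
    have "((\<lambda>x. v x * cos (?\<theta> x)) has_real_derivative
        v x * ?g x * c + v x * (- s * prufer_rhs lam x (?\<theta> x))) (at x within {a..b})"
      unfolding s_def c_def
      by (rule derivative_eq_intros v[OF x] \<theta>[OF x] refl | simp)+
    moreover have "v x * ?g x * c + v x * (- s * prufer_rhs lam x (?\<theta> x))
        = (q x - lam * w x) * (v x * s) * (s\<^sup>2 + c\<^sup>2)"
      unfolding prufer_rhs_def s_def[symmetric] c_def[symmetric]
      by (simp add: power2_eq_square algebra_simps)
    ultimately show "((\<lambda>x. v x * cos (?\<theta> x)) has_real_derivative
        (q x - lam * w x) * (v x * sin (?\<theta> x))) (at x within {a..b})"
      by (simp add: sc) (simp add: s_def)
  qed (simp_all add: v_def)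
qed

text \<open>At a level the solution built from the Pruefer angle satisfies both boundary conditions. Conversely,
  let \<open>u\<close> be an eigenfunction and \<open>v = p u'\<close>. Then \<open>G = u cos \<theta> - v sin \<theta>\<close> solves a homogeneous linear
  equation and vanishes at \<open>a\<close> by the boundary condition, hence everywhere. So \<open>u = H sin \<theta>\<close> and
  \<open>v = H cos \<theta>\<close> with \<open>H = u sin \<theta> + v cos \<theta>\<close>, which cannot vanish at \<open>b\<close> because it also solves a
  homogeneous linear equation and \<open>u\<close> is not zero. Hence the boundary condition at \<open>b\<close> becomes a condition on \<open>\<theta>(b)\<close>.\<close>

lemma sl_eigenvalues_eq_prufer_level_set:
  assumes \<sigma>: "0 < r" "\<sigma>1 = r * cos \<alpha>" "\<sigma>2 = r * sin \<alpha>"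
    and \<zeta>: "0 < R" "\<zeta>1 = R * cos \<beta>" "\<zeta>2 = - R * sin \<beta>"
  shows "sl_eigenvalues a b p q w \<sigma>1 \<sigma>2 \<zeta>1 \<zeta>2 = {lam. sin (prufer \<alpha> lam b - \<beta>) = 0}"
proof (intro Set.set_eqI iffI)
  fix lam assume "lam \<in> {lam. sin (prufer \<alpha> lam b - \<beta>) = 0}"
  then have level: "sin (prufer \<alpha> lam b - \<beta>) = 0" by simp
  let ?\<theta> = "prufer \<alpha> lam"
  obtain u v where u: "\<And>x. u x = v x * sin (?\<theta> x)" and v: "\<And>x. 0 < v x"
    and u': "\<And>x. x \<in> {a..b} \<Longrightarrow>
      (u has_real_derivative v x * cos (?\<theta> x) / p x) (at x within {a..b})"
    and pu': "\<And>x. x \<in> {a..b} \<Longrightarrow> ((\<lambda>x. v x * cos (?\<theta> x)) has_real_derivative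
      (q x - lam * w x) * u x) (at x within {a..b})"
    by (rule prufer_solution[of \<alpha> lam], rule that)
  define du where "du = (\<lambda>x. v x * cos (?\<theta> x) / p x)"
  have pdu: "p x * du x = v x * cos (?\<theta> x)" if "x \<in> {a..b}" for x
    using p_pos[OF that] by (simp add: du_def)
  have "sl_solution a b p q w \<sigma>1 \<sigma>2 \<zeta>1 \<zeta>2 lam u du"
    unfolding sl_solution_def
  proof (intro conjI ballI)
    show "(u has_real_derivative du x) (at x within {a..b})" if "x \<in> {a..b}" for x
      unfolding du_def by (rule u'[OF that])
    show "continuous_on {a..b} du"
      unfolding du_def
      by (intro continuous_intros cont DERIV_continuous_on[OF pu']) (use p_pos in force)+
    show "\<exists>d. ((\<lambda>y. p y * du y) has_real_derivative d) (at x) \<and> - d + q x * u x = lam * w x * u x"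
      if x': "x \<in> {a<..<b}" for x
    proof (intro exI conjI)
      have x: "x \<in> {a..b}" and at: "at x within {a..b} = at x"
        using x' by (auto intro!: at_within_Icc_at)
      show "((\<lambda>y. p y * du y) has_real_derivative (q x - lam * w x) * u x) (at x)"
        by (rule has_field_derivative_transform_within_open[OF pu'[OF x, unfolded at]
              open_greaterThanLessThan x'])
          (use pdu in auto)
    qed (simp add: algebra_simps)
    have "\<sigma>1 * u a - \<sigma>2 * p a * du a = r * v a * (cos \<alpha> * sin (?\<theta> a) - sin \<alpha> * cos (?\<theta> a))"
      using pdu[of a] ab by (simp add: u \<sigma> mult.assoc) (simp add: algebra_simps)
    then show "\<sigma>1 * u a - \<sigma>2 * p a * du a = 0" by (simp add: prufer_init)
    have "\<zeta>1 * u b + \<zeta>2 * p b * du b = R * v b * sin (?\<theta> b - \<beta>)"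
      using pdu[of b] ab by (simp add: u \<zeta> sin_diff mult.assoc) (simp add: algebra_simps)
    then show "\<zeta>1 * u b + \<zeta>2 * p b * du b = 0" by (simp add: level)
  qed
  moreover have "\<exists>x\<in>{a..b}. u x \<noteq> 0"
  proof (rule ccontr)
    assume "\<not> (\<exists>x\<in>{a..b}. u x \<noteq> 0)"
    then have u0: "u x = 0" if "x \<in> {a..b}" for x using that by blast
    define x where "x = (a + b) / 2"
    have x': "x \<in> {a<..<b}" and x: "x \<in> {a..b}" using ab by (auto simp: x_def)
    have at: "at x within {a..b} = at x" using x' by (intro at_within_Icc_at) auto
    have "(u has_real_derivative 0) (at x)"
      by (rule has_field_derivative_transform_within_open[OF DERIV_const[of 0]
            open_greaterThanLessThan x']) (use u0 in auto)
    then have "v x * cos (?\<theta> x) / p x = 0" using u'[OF x, unfolded at] DERIV_unique by blast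
    moreover have "v x * sin (?\<theta> x) = 0" using u0[OF x] u by simp
    ultimately have "cos (?\<theta> x) = 0" "sin (?\<theta> x) = 0" using v[of x] p_pos[OF x] by auto
    then show False using sin_cos_squared_add[of "?\<theta> x"] by simp
  qed
  ultimately show "lam \<in> sl_eigenvalues a b p q w \<sigma>1 \<sigma>2 \<zeta>1 \<zeta>2"
    unfolding sl_eigenvalues_def by blast
next
  fix lam assume "lam \<in> sl_eigenvalues a b p q w \<sigma>1 \<sigma>2 \<zeta>1 \<zeta>2"
  then obtain u u' where sol: "sl_solution a b p q w \<sigma>1 \<sigma>2 \<zeta>1 \<zeta>2 lam u u'"
    and nonzero: "\<exists>x\<in>{a..b}. u x \<noteq> 0"
    unfolding sl_eigenvalues_def by blast
  let ?\<theta> = "prufer \<alpha> lam"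
  define v where "v = (\<lambda>x. p x * u' x)"
  have u_within: "(u has_real_derivative u' x) (at x within {a..b})" if "x \<in> {a..b}" for x
    using sol that by (simp add: sl_solution_def)
  have u: "(u has_real_derivative v x / p x) (at x)" if "x \<in> {a<..<b}" for x
    using u_within[of x] at_within_Icc_at[of a x b] p_pos[of x] that by (simp add: v_def)
  have v: "(v has_real_derivative (q x - lam * w x) * u x) (at x)" if "x \<in> {a<..<b}" for x
  proof -
    have "\<forall>x\<in>{a<..<b}. \<exists>d. (v has_real_derivative d) (at x) \<and>
        - d + q x * u x = lam * w x * u x"
      using sol unfolding sl_solution_def v_def by (elim conjE)
    from bspec[OF this that] obtain d
      where d: "(v has_real_derivative d) (at x)" "- d + q x * u x = lam * w x * u x" by blast
    then have "d = (q x - lam * w x) * u x" by (simp add: algebra_simps)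
    then show ?thesis using d by simp
  qed
  have u_cont: "continuous_on {a..b} u" by (rule DERIV_continuous_on[OF u_within])
  have v_cont: "continuous_on {a..b} v"
    unfolding v_def using sol by (intro continuous_on_mult cont) (simp add: sl_solution_def)
  obtain K where K: "\<And>x. x \<in> {a..b} \<Longrightarrow> 1 / p x + \<bar>q x\<bar> + \<bar>lam\<bar> * w x \<le> K"
    using coefficient_bound[of "\<bar>lam\<bar>"] by (metis order_refl)
  define k where "k x = (1 / p x + q x - lam * w x) * (sin (?\<theta> x) * cos (?\<theta> x))" for x
  have k: "\<bar>k x * y\<bar> \<le> K * \<bar>y\<bar>" if x: "x \<in> {a..b}" for x y
  proof -
    have "\<bar>1 / p x + q x - lam * w x\<bar> \<le> K"
    proof -
      have "\<bar>lam * w x\<bar> = \<bar>lam\<bar> * w x" using w_pos[OF x] by (simp add: abs_mult)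
      moreover have "0 < 1 / p x" using p_pos[OF x] by simp
      ultimately show ?thesis using K[OF x] by linarith
    qed
    moreover have "\<bar>sin (?\<theta> x) * cos (?\<theta> x)\<bar> \<le> 1"
      unfolding abs_mult by (intro mult_le_one) auto
    ultimately have "\<bar>k x\<bar> \<le> K * 1"
      unfolding k_def abs_mult[of "1 / p x + q x - lam * w x"] by (intro mult_mono) auto
    from mult_right_mono[OF this, of "\<bar>y\<bar>"] show ?thesis by (simp add: abs_mult)
  qed
  let ?G = "\<lambda>x. u x * cos (?\<theta> x) - v x * sin (?\<theta> x)"
  let ?H = "\<lambda>x. u x * sin (?\<theta> x) + v x * cos (?\<theta> x)"
  have bca: "\<sigma>1 * u a - \<sigma>2 * v a = 0" and bcb: "\<zeta>1 * u b + \<zeta>2 * v b = 0"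
    using sol by (simp_all add: sl_solution_def v_def mult.assoc)
  have G_deriv: "(?G has_real_derivative - k x * ?G x) (at x)"
    and H_deriv: "(?H has_real_derivative k x * ?H x + (1 / p x + q x - lam * w x)
      * ((cos (?\<theta> x))\<^sup>2 - (sin (?\<theta> x))\<^sup>2) * ?G x) (at x)"
    if x: "x \<in> {a<..<b}" for x
  proof -
    define s where "s = sin (?\<theta> x)"
    define c where "c = cos (?\<theta> x)"
    define P where "P = 1 / p x"
    have sc: "s\<^sup>2 + c\<^sup>2 = 1" by (simp add: s_def c_def)
    note d = u[OF x] v[OF x] prufer_deriv_at[OF x, of \<alpha> lam]
    let ?t = "c\<^sup>2 * P + (lam * w x - q x) * s\<^sup>2"
    have rhs: "prufer_rhs lam x (?\<theta> x) = ?t"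
      by (simp add: prufer_rhs_def s_def c_def P_def)
    have "(?G has_real_derivative (v x * P * c - u x * (s * ?t)
        - ((q x - lam * w x) * u x * s + v x * (c * ?t)))) (at x)"
      unfolding s_def c_def rhs[symmetric, unfolded s_def c_def]
      by (rule derivative_eq_intros d refl | simp add: P_def)+
    moreover have "v x * P * c - u x * (s * ?t) - ((q x - lam * w x) * u x * s + v x * (c * ?t))
        = - ((P + q x - lam * w x) * (s * c)) * (u x * c - v x * s)"
      using sc by Groebner_Basis.algebra
    ultimately show "(?G has_real_derivative - k x * ?G x) (at x)"
      by (simp add: k_def s_def c_def P_def)
    have "(?H has_real_derivative (v x * P * s + u x * (c * ?t)
        + ((q x - lam * w x) * u x * c - v x * (s * ?t)))) (at x)"
      unfolding s_def c_def rhs[symmetric, unfolded s_def c_def]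
      by (rule derivative_eq_intros d refl | simp add: P_def)+
    moreover have "v x * P * s + u x * (c * ?t) + ((q x - lam * w x) * u x * c - v x * (s * ?t))
        = (P + q x - lam * w x) * (s * c) * (u x * s + v x * c)
          + (P + q x - lam * w x) * (c\<^sup>2 - s\<^sup>2) * (u x * c - v x * s)"
      using sc by Groebner_Basis.algebra
    ultimately show "(?H has_real_derivative k x * ?H x + (1 / p x + q x - lam * w x)
      * ((cos (?\<theta> x))\<^sup>2 - (sin (?\<theta> x))\<^sup>2) * ?G x) (at x)"
      by (simp add: k_def s_def c_def P_def)
  qed
  have G0: "?G x = 0" if "x \<in> {a..b}" for x
  proof (rule zero_if_derivative_dominated[OF _ G_deriv _ _ _ that, where c = a and K = K])
    have "r * ?G a = 0" using bca by (simp add: \<sigma> prufer_init algebra_simps)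
    then show "?G a = 0" using \<sigma>(1) by simp
    show "\<bar>- k x * ?G x\<bar> \<le> K * \<bar>?G x\<bar>" if "x \<in> {a<..<b}" for x
      using k[of x "?G x"] that by (simp add: abs_minus_cancel mult_minus_left del: minus_diff_eq)
  qed (use ab in \<open>auto intro!: continuous_intros u_cont v_cont prufer_continuous\<close>)
  have "?H b \<noteq> 0"
  proof
    assume Hb: "?H b = 0"
    have H0: "?H x = 0" if "x \<in> {a..b}" for x
    proof (rule zero_if_derivative_dominated[OF _ H_deriv _ _ Hb that, where K = K])
      show "\<bar>k x * ?H x + (1 / p x + q x - lam * w x)
      * ((cos (?\<theta> x))\<^sup>2 - (sin (?\<theta> x))\<^sup>2) * ?G x\<bar> \<le> K * \<bar>?H x\<bar>" if "x \<in> {a<..<b}" for x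
        using k[of x "?H x"] G0[of x] that by simp
    qed (use ab in \<open>auto intro!: continuous_intros u_cont v_cont prufer_continuous\<close>)
    have "u x = 0" if "x \<in> {a..b}" for x
      using G0[OF that] H0[OF that] sin_cos_squared_add[of "?\<theta> x"] by Groebner_Basis.algebra
    then show False using nonzero by blast
  qed
  moreover have "?H b * (R * sin (?\<theta> b - \<beta>)) = 0"
  proof -
    have "u b = ?H b * sin (?\<theta> b)" "v b = ?H b * cos (?\<theta> b)"
      using G0[of b] ab sin_cos_squared_add[of "?\<theta> b"] by (simp_all, Groebner_Basis.algebra+)
    then have "\<zeta>1 * u b + \<zeta>2 * v b = R * cos \<beta> * (?H b * sin (?\<theta> b)) - R * sin \<beta> * (?H b * cos (?\<theta> b))"
      by (metis \<zeta>(2,3) minus_mult_left uminus_add_conv_diff add.commute)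
    then show ?thesis using bcb by (simp add: sin_diff algebra_simps)
  qed
  ultimately show "lam \<in> {lam. sin (prufer \<alpha> lam b - \<beta>) = 0}" using \<zeta>(1) by simp
qed

end

text \<open>Writing \<open>(\<sigma>1, \<sigma>2)\<close> and \<open>(\<zeta>1, - \<zeta>2)\<close> in polar coordinates gives the initial angle and the
  level of the Pruefer angle.\<close>

theorem sl_eigenvalue_weyl_law:
  assumes ab: "a < b"
    and cont: "continuous_on {a..b} p" "continuous_on {a..b} q" "continuous_on {a..b} w"
    and pos: "\<And>x. x \<in> {a..b} \<Longrightarrow> 0 < p x" "\<And>x. x \<in> {a..b} \<Longrightarrow> 0 < w x"
    and pw: "Ck_on 1 a b (\<lambda>x. p x * w x)"
    and bc: "0 < \<sigma>1\<^sup>2 + \<sigma>2\<^sup>2" "0 < \<zeta>1\<^sup>2 + \<zeta>2\<^sup>2"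
  shows "(\<lambda>k. sl_eigenvalue a b p q w \<sigma>1 \<sigma>2 \<zeta>1 \<zeta>2 k / (real k)\<^sup>2)
    \<longlonglongrightarrow> pi\<^sup>2 / (integral {a..b} (\<lambda>x. sqrt (w x / p x)))\<^sup>2"
    and "0 < integral {a..b} (\<lambda>x. sqrt (w x / p x))"
proof -
  interpret sturm_liouville a b p q w by unfold_locales (use assms in auto)
  have polar: "\<exists>r t. 0 < r \<and> 0 \<le> t \<and> x = r * cos t \<and> y = r * sin t" if "0 < x\<^sup>2 + y\<^sup>2" for x y :: real
  proof -
    define r where "r = sqrt (x\<^sup>2 + y\<^sup>2)"
    have r: "0 < r" "r\<^sup>2 = x\<^sup>2 + y\<^sup>2" using that by (auto simp: r_def)
    have "(x / r)\<^sup>2 + (y / r)\<^sup>2 = (x\<^sup>2 + y\<^sup>2) / r\<^sup>2"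
      by (simp add: power_divide add_divide_distrib)
    also have "\<dots> = 1" using r by (metis divide_self less_irrefl that)
    finally obtain t where "0 \<le> t" "x / r = cos t" "y / r = sin t" by (rule sincos_total_2pi)
    then show ?thesis using r(1) by (intro exI[of _ r] exI[of _ t]) (auto simp: field_simps)
  qed
  obtain r \<alpha> where \<alpha>: "0 < r" "0 \<le> \<alpha>" "\<sigma>1 = r * cos \<alpha>" "\<sigma>2 = r * sin \<alpha>"
    using polar[OF bc(1)] by blast
  have "0 < \<zeta>1\<^sup>2 + (- \<zeta>2)\<^sup>2" using bc(2) by simp
  then obtain R \<beta> where \<beta>: "0 < R" "\<zeta>1 = R * cos \<beta>" "- \<zeta>2 = R * sin \<beta>"
    using polar by blast
  from \<beta>(3) have \<beta>3: "\<zeta>2 = - R * sin \<beta>" by simp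
  obtain m where m: "\<And>x. x \<in> {a..b} \<Longrightarrow>
      ((\<lambda>x. p x * w x) has_real_derivative m x) (at x within {a..b})" "continuous_on {a..b} m"
    using pw unfolding One_nat_def Ck_on.simps by blast
  let ?B = "integral {a..b} (\<lambda>x. sqrt (w x / p x))"
  have contR: "continuous_on {a..b} (\<lambda>x. sqrt (w x / p x))"
    by (intro continuous_intros cont) (use p_pos in force)
  show B: "0 < ?B"
  proof -
    have "?B \<noteq> 0"
    proof
      assume "?B = 0"
      then have "\<forall>x\<in>{a..b}. sqrt (w x / p x) = 0"
        using integral_eq_0_iff[OF contR ab] pos by (simp add: less_imp_le)
      then have "sqrt (w a / p a) = 0" using ab by auto
      then show False using pos[of a] ab by simp
    qed
    moreover have "0 \<le> ?B"
      by (rule integral_nonneg[OF integrable_continuous_real[OF contR]])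
        (use pos in \<open>simp add: less_imp_le\<close>)
    ultimately show ?thesis by simp
  qed
  obtain C where "\<And>lam. 1 \<le> lam \<Longrightarrow> \<bar>prufer \<alpha> lam b - ?B * sqrt lam\<bar> \<le> C"
    using prufer_asymptotics[OF m] by blast
  from angle_level_set_asymptotics[OF prufer_continuous_parameter prufer_strict_mono
      prufer_nonneg this B sl_eigenvalues_eq_prufer_level_set[OF \<alpha>(1,3,4) \<beta>(1,2) \<beta>3]]
  show "(\<lambda>k. sl_eigenvalue a b p q w \<sigma>1 \<sigma>2 \<zeta>1 \<zeta>2 k / (real k)\<^sup>2) \<longlonglongrightarrow> pi\<^sup>2 / ?B\<^sup>2"
    using \<alpha>(2) ab by (simp add: sl_eigenvalue_def Let_def)
qed

section \<open>Eigenvalues of scaled matrices\<close>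

lemma proots_prod_linear_factors: "proots (\<Prod>e\<leftarrow>es. [:- e, 1:]) = mset (es :: 'a :: idom list)"
proof (induction es)
  case (Cons e es)
  have "(\<Prod>e\<leftarrow>es. [:- e, 1:]) \<noteq> 0" by (auto simp: prod_list_zero_iff)
  then show ?case using Cons by (simp add: proots_mult del: mult_pCons_left)
qed simp

text \<open>Only the multiset of eigenvalues is compared, because non-real eigenvalues with equal real parts may
  be listed in any order. The characteristic polynomials are compared pointwise, through
  \<open>det (x - r A) = r\<^sup>n det (x / r - A)\<close>.\<close>

lemma mset_eigenvalue_list_smult:
  assumes A: "A \<in> carrier_mat n n" and r: "r \<noteq> 0"
  shows "mset (eigenvalue_list (r \<cdot>\<^sub>m A)) = image_mset ((*) r) (mset (eigenvalue_list A))"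
proof -
  let ?es = "eigenvalue_list A"
  have rA: "r \<cdot>\<^sub>m A \<in> carrier_mat n n" using A by simp
  have "char_poly (r \<cdot>\<^sub>m A) = (\<Prod>e\<leftarrow>map ((*) r) ?es. [:- e, 1:])"
  proof (rule poly_ext)
    fix x
    have poly_prod: "poly (\<Prod>e\<leftarrow>es. [:- e, 1:]) x = (\<Prod>e\<leftarrow>es. x - e)" for x and es :: "complex list"
      by (induction es) (auto simp: algebra_simps)
    have scale: "r ^ length es * (\<Prod>e\<leftarrow>es. x / r - e) = (\<Prod>e\<leftarrow>map ((*) r) es. x - e)" for es
    proof (induction es)
      case (Cons e es)
      have "r ^ length (e # es) * (\<Prod>e\<leftarrow>e # es. x / r - e)
          = (r * (x / r - e)) * (r ^ length es * (\<Prod>e\<leftarrow>es. x / r - e))" by simp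
      also have "r * (x / r - e) = x - r * e" using r by (simp add: right_diff_distrib)
      finally show ?case unfolding Cons by simp
    qed simp
    have "- char_matrix (r \<cdot>\<^sub>m A) x = r \<cdot>\<^sub>m (- char_matrix A (x / r))"
      using A r by (intro eq_matI) (auto simp: char_matrix_def algebra_simps)
    then have "poly (char_poly (r \<cdot>\<^sub>m A)) x = r ^ n * poly (char_poly A) (x / r)"
      using A carrier_matD[OF char_matrix_closed[OF A]]
      unfolding char_poly_matrix[OF rA] char_poly_matrix[OF A] by simp
    also have "\<dots> = r ^ length ?es * (\<Prod>e\<leftarrow>?es. x / r - e)"
      unfolding eigenvalue_list(1)[OF A] poly_prod eigenvalue_list(2)[OF A] ..
    also have "\<dots> = poly (\<Prod>e\<leftarrow>map ((*) r) ?es. [:- e, 1:]) x"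
      unfolding scale poly_prod ..
    finally show "poly (char_poly (r \<cdot>\<^sub>m A)) x = poly (\<Prod>e\<leftarrow>map ((*) r) ?es. [:- e, 1:]) x" .
  qed
  then have "(\<Prod>e\<leftarrow>eigenvalue_list (r \<cdot>\<^sub>m A). [:- e, 1:]) = (\<Prod>e\<leftarrow>map ((*) r) ?es. [:- e, 1:])"
    using eigenvalue_list(1)[OF rA] by simp
  then have "mset (eigenvalue_list (r \<cdot>\<^sub>m A)) = mset (map ((*) r) ?es)"
    by (metis proots_prod_linear_factors)
  then show ?thesis by simp
qed

lemma sum_mat_eigenvalue:
  assumes "A \<in> carrier_mat n n"
  shows "(\<Sum>k=1..n. F (mat_eigenvalue A k)) = (\<Sum>e\<in>#mset (eigenvalue_list A). F e)"
proof -
  have "(\<Sum>k=1..n. F (mat_eigenvalue A k)) = (\<Sum>i<n. F (eigenvalue_list A ! i))"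
    by (rule sum.reindex_bij_witness[where i = Suc and j = "\<lambda>k. k - 1"])
      (auto simp: mat_eigenvalue_def)
  also have "\<dots> = sum_list (map F (eigenvalue_list A))"
    using eigenvalue_list(2)[OF assms] by (simp add: sum_list_sum_nth atLeast0LessThan)
  also have "\<dots> = (\<Sum>e\<in>#mset (eigenvalue_list A). F e)"
    by (metis mset_map sum_mset_sum_list)
  finally show ?thesis .
qed

lemma sum_mat_eigenvalue_smult:
  assumes "A \<in> carrier_mat n n" "r \<noteq> 0"
  shows "(\<Sum>k=1..n. F (mat_eigenvalue (r \<cdot>\<^sub>m A) k)) = (\<Sum>k=1..n. F (r * mat_eigenvalue A k))"
  using sum_mat_eigenvalue[of "r \<cdot>\<^sub>m A" n F] sum_mat_eigenvalue[OF assms(1), of "\<lambda>z. F (r * z)"]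
  by (simp add: assms mset_eigenvalue_list_smult[OF assms] multiset.map_comp o_def)

section \<open>Essential range and monotone rearrangement\<close>

locale bounded_symbol =
  fixes D :: "'a::euclidean_space set" and \<omega> :: "'a \<Rightarrow> real"
  assumes D: "D \<in> lmeasurable" "0 < measure lebesgue D"
    and meas: "\<omega> \<in> borel_measurable (lebesgue_on D)"
    and bounded: "\<exists>C. AE x in lebesgue_on D. \<bar>\<omega> x\<bar> \<le> C"
begin

lemma D_sets: "D \<in> sets lebesgue"
  using D(1) by (rule fmeasurableD)

lemma finite_measure_symbol_domain: "finite_measure (lebesgue_on D)"
  using D(1) by (rule finite_measure_lebesgue_on)

lemma measure_eq: "Measurable.pred (lebesgue_on D) P \<Longrightarrow>
    measure lebesgue {x\<in>D. P x} = measure (lebesgue_on D) {x\<in>D. P x}"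
  using D_sets by (simp add: measure_restrict_space)

lemma not_AE_False: "\<not> (AE x in lebesgue_on D. False)"
proof
  assume "AE x in lebesgue_on D. False"
  then have "emeasure (lebesgue_on D) (space (lebesgue_on D)) = 0"
    using ae_filter_eq_bot_iff[of "lebesgue_on D"] by (simp add: eventually_False)
  then have "emeasure lebesgue D = 0" using D_sets by (simp add: emeasure_restrict_space)
  then show False using D(2) by (simp add: measure_def)
qed

lemma measure_zero_iff_AE:
  assumes "Measurable.pred (lebesgue_on D) P"
  shows "measure lebesgue {x\<in>D. P x} = 0 \<longleftrightarrow> (AE x in lebesgue_on D. \<not> P x)"
proof -
  interpret finite_measure "lebesgue_on D" by (rule finite_measure_symbol_domain)
  have sets: "{x\<in>D. P x} \<in> sets (lebesgue_on D)"
    using assms by (simp add: pred_def)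
  have "(AE x in lebesgue_on D. \<not> P x) \<longleftrightarrow> emeasure (lebesgue_on D) {x\<in>D. P x} = 0"
    by (rule AE_iff_measurable[OF sets]) simp
  also have "\<dots> \<longleftrightarrow> measure (lebesgue_on D) {x\<in>D. P x} = 0"
    by (simp add: emeasure_eq_measure)
  finally show ?thesis unfolding measure_eq[OF assms] ..
qed

lemma pred_ball: "Measurable.pred (lebesgue_on D) (\<lambda>x. norm (\<omega> x - t) < \<epsilon>)"
  and pred_le: "Measurable.pred (lebesgue_on D) (\<lambda>x. \<omega> x \<le> t)"
  and pred_gt: "Measurable.pred (lebesgue_on D) (\<lambda>x. t < \<omega> x)"
  using meas by measurable

lemma not_in_ess_range:
  "t \<notin> ess_range D \<omega> \<longleftrightarrow> (\<exists>\<epsilon>>0. AE x in lebesgue_on D. \<not> norm (\<omega> x - t) < \<epsilon>)"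
proof -
  have "t \<notin> ess_range D \<omega> \<longleftrightarrow> (\<exists>\<epsilon>>0. measure lebesgue {x\<in>D. norm (\<omega> x - t) < \<epsilon>} = 0)"
    by (auto simp: ess_range_def not_less measure_le_0_iff)
  then show ?thesis unfolding measure_zero_iff_AE[OF pred_ball] .
qed

text \<open>Every point outside the essential range has a neighbourhood that \<open>\<omega>\<close> almost surely avoids, and
  by Lindelof's theorem countably many of these neighbourhoods cover the complement.\<close>

lemma AE_in_ess_range: "AE x in lebesgue_on D. \<omega> x \<in> ess_range D \<omega>"
proof -
  define \<U> where "\<U> = {U :: real set. open U \<and> (AE x in lebesgue_on D. \<omega> x \<notin> U)}"
  have open_\<U>: "\<And>S. S \<in> \<U> \<Longrightarrow> open S" by (simp add: \<U>_def)
  obtain \<V> where \<V>: "\<V> \<subseteq> \<U>" "countable \<V>" "\<Union>\<V> = \<Union>\<U>"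
    by (rule Lindelof[of \<U>], erule open_\<U>, rule that)
  have "t \<in> \<Union>\<U>" if "t \<notin> ess_range D \<omega>" for t
  proof -
    from that[unfolded not_in_ess_range] obtain \<epsilon>
      where "\<epsilon> > 0" "AE x in lebesgue_on D. \<not> norm (\<omega> x - t) < \<epsilon>" by blast
    then have "ball t \<epsilon> \<in> \<U>" "t \<in> ball t \<epsilon>"
      by (auto simp: \<U>_def dist_real_def abs_minus_commute)
    then show ?thesis by blast
  qed
  moreover have "AE x in lebesgue_on D. \<forall>V\<in>\<V>. \<omega> x \<notin> V"
    using \<V>(1,2) by (subst AE_ball_countable) (auto simp: \<U>_def)
  ultimately show ?thesis
    unfolding \<V>(3)[symmetric] by (elim eventually_mono) blast
qed

lemma ess_range_le_AE_bound:
  assumes "AE x in lebesgue_on D. \<omega> x \<le> z" "t \<in> ess_range D \<omega>"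
  shows "t \<le> z"
proof (rule ccontr)
  assume "\<not> t \<le> z"
  then have "AE x in lebesgue_on D. \<not> norm (\<omega> x - t) < t - z"
    using assms(1) by (auto elim!: eventually_mono)
  then show False using assms(2) not_in_ess_range[of t] \<open>\<not> t \<le> z\<close> by auto
qed

lemma ess_range_ge_AE_bound:
  assumes "AE x in lebesgue_on D. z \<le> \<omega> x" "t \<in> ess_range D \<omega>"
  shows "z \<le> t"
proof (rule ccontr)
  assume "\<not> z \<le> t"
  then have "AE x in lebesgue_on D. \<not> norm (\<omega> x - t) < z - t"
    using assms(1) by (auto elim!: eventually_mono)
  then show False using assms(2) not_in_ess_range[of t] \<open>\<not> z \<le> t\<close> by auto
qed

lemma ess_range_nonempty: "ess_range D \<omega> \<noteq> {}"
  using AE_in_ess_range not_AE_False by auto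

lemma bdd_ess_range: "bdd_above (ess_range D \<omega>)" "bdd_below (ess_range D \<omega>)"
proof -
  obtain C where C: "AE x in lebesgue_on D. \<bar>\<omega> x\<bar> \<le> C" using bounded by blast
  have "AE x in lebesgue_on D. \<omega> x \<le> C" "AE x in lebesgue_on D. - C \<le> \<omega> x"
    by (rule eventually_mono[OF C]; simp)+
  from ess_range_le_AE_bound[OF this(1)] ess_range_ge_AE_bound[OF this(2)]
  show "bdd_above (ess_range D \<omega>)" "bdd_below (ess_range D \<omega>)"
    unfolding bdd_above_def bdd_below_def by blast+
qed

lemma AE_le_iff_Sup_ess_range_le:
  "(AE x in lebesgue_on D. \<omega> x \<le> z) \<longleftrightarrow> Sup (ess_range D \<omega>) \<le> z"
proof
  assume "AE x in lebesgue_on D. \<omega> x \<le> z"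
  then show "Sup (ess_range D \<omega>) \<le> z"
    using ess_range_nonempty ess_range_le_AE_bound by (intro cSup_least)
next
  assume z: "Sup (ess_range D \<omega>) \<le> z"
  show "AE x in lebesgue_on D. \<omega> x \<le> z"
    using AE_in_ess_range
  proof eventually_elim
    case (elim x)
    then show ?case using cSup_upper[OF elim bdd_ess_range(1)] z by linarith
  qed
qed

lemma distribution_fun_ge_1_iff: "1 \<le> distribution_fun D \<omega> t \<longleftrightarrow> Sup (ess_range D \<omega>) \<le> t"
proof -
  interpret finite_measure "lebesgue_on D" by (rule finite_measure_symbol_domain)
  have sets: "{x\<in>D. \<omega> x \<le> t} \<in> sets (lebesgue_on D)" "{x\<in>D. t < \<omega> x} \<in> sets (lebesgue_on D)"
    using pred_le pred_gt D_sets by (simp_all add: pred_def)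
  have "measure (lebesgue_on D) ({x\<in>D. \<omega> x \<le> t} \<union> {x\<in>D. t < \<omega> x})
      = measure (lebesgue_on D) {x\<in>D. \<omega> x \<le> t} + measure (lebesgue_on D) {x\<in>D. t < \<omega> x}"
    by (rule finite_measure_Union[OF sets]) auto
  moreover have "{x\<in>D. \<omega> x \<le> t} \<union> {x\<in>D. t < \<omega> x} = D" by auto
  moreover have "measure (lebesgue_on D) D = measure lebesgue D"
    using D_sets by (simp add: measure_restrict_space)
  ultimately have "measure lebesgue {x\<in>D. \<omega> x \<le> t}
      = measure lebesgue D - measure lebesgue {x\<in>D. t < \<omega> x}"
    using measure_eq[OF pred_le, of t] measure_eq[OF pred_gt, of t] by simp
  then have "1 \<le> distribution_fun D \<omega> t \<longleftrightarrow> measure lebesgue {x\<in>D. t < \<omega> x} = 0"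
    using D(2) by (simp add: distribution_fun_def le_divide_eq measure_le_0_iff)
  also have "\<dots> \<longleftrightarrow> (AE x in lebesgue_on D. \<omega> x \<le> t)"
    by (simp add: measure_zero_iff_AE[OF pred_gt] not_less)
  finally show ?thesis by (simp add: AE_le_iff_Sup_ess_range_le)
qed

lemma distribution_fun_eq_0:
  assumes "t < Inf (ess_range D \<omega>)"
  shows "distribution_fun D \<omega> t = 0"
proof -
  have "AE x in lebesgue_on D. \<not> \<omega> x \<le> t"
    using AE_in_ess_range
  proof eventually_elim
    case (elim x)
    then show ?case using cInf_lower[OF elim bdd_ess_range(2)] assms by linarith
  qed
  then show ?thesis using measure_zero_iff_AE[OF pred_le, of t] by (simp add: distribution_fun_def)
qed

text \<open>The distribution function vanishes below the infimum of the essential range and reaches \<open>1\<close> at its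
  supremum. So a point \<open>y\<close> as in the hypothesis lies in the interval to which the definition of the
  rearrangement restricts \<open>t\<close>.\<close>

lemma monotone_rearrangement_eqI:
  assumes x: "0 < x" "x \<le> 1" and y: "\<And>t. x \<le> distribution_fun D \<omega> t \<longleftrightarrow> y \<le> t"
  shows "monotone_rearrangement D \<omega> x = y"
proof -
  have "y \<le> Sup (ess_range D \<omega>)"
    using y[of "Sup (ess_range D \<omega>)"] distribution_fun_ge_1_iff x by (meson order_refl order_trans)
  moreover have "Inf (ess_range D \<omega>) \<le> y"
    using y[of y] distribution_fun_eq_0[of y] x by (cases "y < Inf (ess_range D \<omega>)") auto
  ultimately have "{t \<in> {Inf (ess_range D \<omega>)..Sup (ess_range D \<omega>)}. distribution_fun D \<omega> t \<ge> x}
      = {y..Sup (ess_range D \<omega>)}" "y \<le> Sup (ess_range D \<omega>)"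
    unfolding y by auto
  then show ?thesis by (simp add: monotone_rearrangement_def)
qed

lemma monotone_rearrangement_1: "monotone_rearrangement D \<omega> 1 = Sup (ess_range D \<omega>)"
  by (rule monotone_rearrangement_eqI) (simp_all add: distribution_fun_ge_1_iff)

lemma esssup_eq_Sup_ess_range:
  "esssup (lebesgue_on D) (\<lambda>x. ereal (\<omega> x)) = ereal (Sup (ess_range D \<omega>))"
proof -
  have "(\<lambda>x. ereal (\<omega> x)) \<in> borel_measurable (lebesgue_on D)" using meas by measurable
  then have "esssup (lebesgue_on D) (\<lambda>x. ereal (\<omega> x))
      = Inf {z. AE x in lebesgue_on D. ereal (\<omega> x) \<le> z}" by (rule esssup_eq_AE)
  also have "\<dots> = ereal (Sup (ess_range D \<omega>))"
  proof (rule antisym)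
    show "Inf {z. AE x in lebesgue_on D. ereal (\<omega> x) \<le> z} \<le> ereal (Sup (ess_range D \<omega>))"
      by (rule Inf_lower) (simp add: AE_le_iff_Sup_ess_range_le)
    show "ereal (Sup (ess_range D \<omega>)) \<le> Inf {z. AE x in lebesgue_on D. ereal (\<omega> x) \<le> z}"
    proof (rule Inf_greatest)
      fix z assume "z \<in> {z. AE x in lebesgue_on D. ereal (\<omega> x) \<le> z}"
      then show "ereal (Sup (ess_range D \<omega>)) \<le> z"
        using not_AE_False by (cases z) (auto simp: AE_le_iff_Sup_ess_range_le)
    qed
  qed
  finally show ?thesis .
qed

end

section \<open>Empirical eigenvalue distributions close to scaled squares\<close>

lemma card_scaled_squares_le:
  fixes c s :: real
  assumes "0 < c"
  shows "real (card {k\<in>{1..n}. c * (real k / real n)\<^sup>2 \<le> s}) \<le> real n * sqrt (max 0 s / c)"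
proof -
  let ?x = "real n * sqrt (max 0 s / c)"
  have "{k\<in>{1..n}. c * (real k / real n)\<^sup>2 \<le> s} \<subseteq> {1..nat \<lfloor>?x\<rfloor>}"
  proof
    fix k assume k: "k \<in> {k\<in>{1..n}. c * (real k / real n)\<^sup>2 \<le> s}"
    then have n: "0 < n" by auto
    have "c * (real k / real n)\<^sup>2 \<le> max 0 s" using k by auto
    then have "(real k / real n)\<^sup>2 \<le> max 0 s / c"
      using assms by (simp only: pos_le_divide_eq mult.commute)
    then have "real k / real n \<le> sqrt (max 0 s / c)" by (rule real_le_rsqrt)
    then have "real k \<le> ?x" using n by (simp add: field_simps)
    then show "k \<in> {1..nat \<lfloor>?x\<rfloor>}" using k by (simp add: le_nat_floor)
  qed
  then have "card {k\<in>{1..n}. c * (real k / real n)\<^sup>2 \<le> s} \<le> nat \<lfloor>?x\<rfloor>"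
    using card_mono[of "{1..nat \<lfloor>?x\<rfloor>}"] by simp
  moreover have "0 \<le> ?x" using assms by simp
  ultimately show ?thesis by linarith
qed

lemma card_scaled_squares_ge:
  fixes c s :: real
  assumes "0 < c"
  shows "real n * min 1 (sqrt (max 0 s / c)) - 1
    \<le> real (card {k\<in>{1..n}. c * (real k / real n)\<^sup>2 \<le> s})"
proof -
  let ?r = "min 1 (sqrt (max 0 s / c))"
  have r: "0 \<le> ?r" using assms by simp
  have "{1..nat \<lfloor>real n * ?r\<rfloor>} \<subseteq> {k\<in>{1..n}. c * (real k / real n)\<^sup>2 \<le> s}"
  proof
    fix k assume k: "k \<in> {1..nat \<lfloor>real n * ?r\<rfloor>}"
    have nr: "0 \<le> real n * ?r" using r by (rule mult_nonneg_nonneg[OF of_nat_0_le_iff])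
    have k1: "1 \<le> k" and "k \<le> nat \<lfloor>real n * ?r\<rfloor>" using k by auto
    then have kn: "real k \<le> real n * ?r" using nr by linarith
    also have "\<dots> \<le> real n * 1" by (intro mult_left_mono) auto
    finally have "k \<le> n" by simp
    then have n: "0 < n" using k1 by simp
    have "real k / real n \<le> ?r" using kn n by (simp only: pos_divide_le_eq of_nat_0_less_iff mult.commute)
    then have le: "real k / real n \<le> sqrt (max 0 s / c)" by simp
    moreover have "0 < real k / real n" using k1 n by simp
    ultimately have "0 < max 0 s / c" by (metis less_le_trans real_sqrt_gt_0_iff)
    then have s: "0 < s" using assms by (simp add: zero_less_divide_iff split: if_splits)
    have "(real k / real n)\<^sup>2 \<le> (sqrt (max 0 s / c))\<^sup>2" using le by (intro power_mono) auto
    also have "\<dots> = s / c" using s assms by simp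
    finally have "c * (real k / real n)\<^sup>2 \<le> s" using assms by (simp add: field_simps)
    then show "k \<in> {k\<in>{1..n}. c * (real k / real n)\<^sup>2 \<le> s}" using k1 \<open>k \<le> n\<close> by simp
  qed
  then have "card {1..nat \<lfloor>real n * ?r\<rfloor>} \<le> card {k\<in>{1..n}. c * (real k / real n)\<^sup>2 \<le> s}"
    by (intro card_mono) auto
  then have "nat \<lfloor>real n * ?r\<rfloor> \<le> card {k\<in>{1..n}. c * (real k / real n)\<^sup>2 \<le> s}"
    by (simp only: card_atLeastAtMost diff_Suc_1)
  then show ?thesis by linarith
qed

text \<open>A continuous function of \<open>y\<close> between the indicator functions of \<open>{..t}\<close> and \<open>{..t + \<delta>}\<close>.\<close>

definition ramp :: "real \<Rightarrow> real \<Rightarrow> real \<Rightarrow> real" where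
  "ramp t \<delta> y = max 0 (min 1 ((t + \<delta> - y) / \<delta>))"

lemma ramp_bounds: "0 \<le> ramp t \<delta> y" "ramp t \<delta> y \<le> 1"
  by (auto simp: ramp_def)

lemma ramp_eq_1: "0 < \<delta> \<Longrightarrow> y \<le> t \<Longrightarrow> ramp t \<delta> y = 1"
  by (simp add: ramp_def le_divide_eq)

lemma ramp_eq_0: "0 < \<delta> \<Longrightarrow> t + \<delta> \<le> y \<Longrightarrow> ramp t \<delta> y = 0"
  using divide_nonpos_pos[of "t + \<delta> - y" \<delta>] by (simp add: ramp_def)

text \<open>The second factor, which is \<open>1\<close> on the disc of radius \<open>R\<close>, makes the support compact.\<close>

definition test_fun :: "real \<Rightarrow> real \<Rightarrow> real \<Rightarrow> complex \<Rightarrow> real" where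
  "test_fun R t \<delta> z = ramp t \<delta> (Re z) * max 0 (min 1 (R + 1 - cmod z))"

lemma test_fun_bounds: "0 \<le> test_fun R t \<delta> z" "test_fun R t \<delta> z \<le> 1"
  unfolding test_fun_def using ramp_bounds by (auto intro!: mult_nonneg_nonneg mult_le_one)

lemma test_fun_continuous: "\<delta> \<noteq> 0 \<Longrightarrow> continuous_on UNIV (test_fun R t \<delta>)"
  unfolding test_fun_def[abs_def] ramp_def by (intro continuous_intros) auto

lemma test_fun_compact_support: "compact (closure {z. complex_of_real (test_fun R t \<delta> z) \<noteq> 0})"
proof -
  have "{z. complex_of_real (test_fun R t \<delta> z) \<noteq> 0} \<subseteq> cball 0 (R + 1)"
    by (auto simp: test_fun_def max_def min_def split: if_splits)
  then show ?thesis by (simp add: bounded_subset[OF bounded_cball])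
qed

context bounded_symbol
begin

text \<open>The test functions of a spectral symbol are continuous, so the indicator function of \<open>{..t}\<close> is
  bracketed by ramps of width \<open>\<delta>\<close>. Replacing \<open>z n k\<close> by \<open>c (k / n)\<^sup>2\<close> costs another \<open>\<delta>\<close>, so that
  counting the squares at most \<open>t \<plusminus> 2 \<delta>\<close> bounds the averages of the ramps. The first \<open>N\<close> indices
  contribute at most \<open>N / n\<close>. Finally \<open>\<delta>\<close> tends to \<open>0\<close>.\<close>

lemma distribution_fun_bounds_if_scaled_squares:
  fixes z :: "nat \<Rightarrow> nat \<Rightarrow> complex"
  assumes c: "0 < c"
    and lim: "\<And>F :: complex \<Rightarrow> complex. continuous_on UNIV F \<Longrightarrow> compact (closure {z. F z \<noteq> 0}) \<Longrightarrow>
        (\<lambda>n. (\<Sum>k=1..n. F (z n k)) / of_nat n)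
          \<longlonglongrightarrow> (LINT x|lebesgue_on D. F (complex_of_real (\<omega> x))) / of_real (measure lebesgue D)"
    and approx: "\<And>\<eta>. 0 < \<eta> \<Longrightarrow> \<exists>N. \<forall>n. \<forall>k\<in>{N..n}.
        cmod (z n k - of_real (c * (real k / real n)\<^sup>2)) \<le> \<eta>"
  shows "distribution_fun D \<omega> t \<le> sqrt (max 0 t / c)"
    and "min 1 (sqrt (max 0 t / c)) \<le> distribution_fun D \<omega> t"
proof -
  interpret finite_measure "lebesgue_on D" by (rule finite_measure_symbol_domain)
  obtain C where C: "AE x in lebesgue_on D. \<bar>\<omega> x\<bar> \<le> C" using bounded by blast
  \<comment> \<open>the disc of radius \<open>R\<close> contains almost all values of \<open>\<omega>\<close> and all points within distance \<open>1\<close> of \<open>[0, c]\<close>\<close>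
  define R where "R = max C (c + 1)"
  let ?g = "\<lambda>s \<delta>. test_fun R s \<delta>"
  have meas_g: "(\<lambda>x. ?g s \<delta> (complex_of_real (\<omega> x))) \<in> borel_measurable (lebesgue_on D)"
    if "\<delta> \<noteq> 0" for s \<delta>
    using meas borel_measurable_continuous_onI[OF test_fun_continuous[OF that, of R s]] by measurable
  have int_g: "integrable (lebesgue_on D) (\<lambda>x. ?g s \<delta> (complex_of_real (\<omega> x)))" if "\<delta> \<noteq> 0" for s \<delta>
    using test_fun_bounds by (intro integrable_const_bound[where B = 1] meas_g[OF that]) auto
  have lim_g: "(\<lambda>n. (\<Sum>k=1..n. ?g s \<delta> (z n k)) / real n)
      \<longlonglongrightarrow> (LINT x|lebesgue_on D. ?g s \<delta> (complex_of_real (\<omega> x))) / measure lebesgue D"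
    if "\<delta> \<noteq> 0" for s \<delta>
  proof -
    have "(\<lambda>n. complex_of_real ((\<Sum>k=1..n. ?g s \<delta> (z n k)) / real n)) \<longlonglongrightarrow>
        complex_of_real ((LINT x|lebesgue_on D. ?g s \<delta> (complex_of_real (\<omega> x))) / measure lebesgue D)"
      using lim[of "\<lambda>z. complex_of_real (?g s \<delta> z)", OF _ test_fun_compact_support]
      by (simp add: continuous_on_of_real test_fun_continuous[OF that])
    then show ?thesis by (simp only: tendsto_of_real_iff)
  qed
  have sets: "{x\<in>D. \<omega> x \<le> t} \<in> sets (lebesgue_on D)"
    using pred_le by (simp add: pred_def)
  have int_ind: "integrable (lebesgue_on D) (\<lambda>x. indicator {x\<in>D. \<omega> x \<le> t} x :: real)"
    using sets by (intro integrable_real_indicator) (auto simp: emeasure_eq_measure)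
  have "distribution_fun D \<omega> t = measure (lebesgue_on D) {x\<in>D. \<omega> x \<le> t} / measure lebesgue D"
    by (simp add: distribution_fun_def measure_eq[OF pred_le])
  also have "measure (lebesgue_on D) {x\<in>D. \<omega> x \<le> t}
      = (LINT x|lebesgue_on D. indicator {x\<in>D. \<omega> x \<le> t} x)"
    using sets by (simp add: Int_absorb2 sets.sets_into_space)
  finally have dist: "distribution_fun D \<omega> t
      = (LINT x|lebesgue_on D. indicator {x\<in>D. \<omega> x \<le> t} x) / measure lebesgue D" .

  have upper: "distribution_fun D \<omega> t \<le> sqrt (max 0 (t + 2 * \<delta>) / c)" if \<delta>: "0 < \<delta>" for \<delta>
  proof -
    obtain N where N: "\<And>n k. k \<in> {N..n} \<Longrightarrow> cmod (z n k - of_real (c * (real k / real n)\<^sup>2)) \<le> \<delta>"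
      using approx[OF \<delta>] by blast
    have "distribution_fun D \<omega> t
        \<le> (LINT x|lebesgue_on D. ?g t \<delta> (complex_of_real (\<omega> x))) / measure lebesgue D"
      unfolding dist
    proof (intro divide_right_mono integral_mono_AE int_ind int_g)
      show "AE x in lebesgue_on D. indicator {x\<in>D. \<omega> x \<le> t} x \<le> ?g t \<delta> (complex_of_real (\<omega> x))"
        using C
      proof eventually_elim
        case (elim x)
        then have "cmod (complex_of_real (\<omega> x)) \<le> R" by (simp add: R_def)
        then show ?case
          using \<delta> ramp_bounds(1)[of t \<delta>] by (auto simp: indicator_def test_fun_def ramp_eq_1)
      qed
    qed (use \<delta> in auto)
    also have "\<dots> \<le> 0 + sqrt (max 0 (t + 2 * \<delta>) / c)"
    proof (rule LIMSEQ_le[OF lim_g])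
      show "(\<lambda>n. real N / real n + sqrt (max 0 (t + 2 * \<delta>) / c))
          \<longlonglongrightarrow> 0 + sqrt (max 0 (t + 2 * \<delta>) / c)"
        by (intro tendsto_intros lim_const_over_n)
      have "(\<Sum>k=1..n. ?g t \<delta> (z n k)) / real n \<le> real N / real n + sqrt (max 0 (t + 2 * \<delta>) / c)"
        if n: "0 < n" for n
      proof -
        define S where "S = {k\<in>{1..n}. c * (real k / real n)\<^sup>2 \<le> t + 2 * \<delta>}"
        have "?g t \<delta> (z n k) \<le> of_bool (k < N) + of_bool (k \<in> S)" if k: "k \<in> {1..n}" for k
        proof (cases "N \<le> k \<and> k \<notin> S")
          case True
          then have "\<bar>Re (z n k - of_real (c * (real k / real n)\<^sup>2))\<bar> \<le> \<delta>"
            using N[of k n] k by (intro order_trans[OF abs_Re_le_cmod]) auto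
          then have "t + \<delta> \<le> Re (z n k)" using True k by (auto simp: S_def)
          then show ?thesis using \<delta> by (simp add: test_fun_def ramp_eq_0)
        next
          case False
          then show ?thesis using test_fun_bounds(2)[of R t \<delta> "z n k"] by (auto simp: of_bool_def)
        qed
        then have "(\<Sum>k=1..n. ?g t \<delta> (z n k)) \<le> (\<Sum>k=1..n. of_bool (k < N) + of_bool (k \<in> S))"
          by (rule sum_mono)
        also have "\<dots> = real (card ({1..n} \<inter> {k. k < N})) + real (card ({1..n} \<inter> S))"
          by (simp add: sum.distrib)
        also have "\<dots> \<le> real N + real n * sqrt (max 0 (t + 2 * \<delta>) / c)"
        proof (intro add_mono)
          have "card ({1..n} \<inter> {k. k < N}) \<le> card {..<N}" by (intro card_mono) auto
          then show "real (card ({1..n} \<inter> {k. k < N})) \<le> real N" by simp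
          have "{1..n} \<inter> S = S" by (auto simp: S_def)
          then show "real (card ({1..n} \<inter> S)) \<le> real n * sqrt (max 0 (t + 2 * \<delta>) / c)"
            using card_scaled_squares_le[OF c, of n "t + 2 * \<delta>"] by (simp add: S_def)
        qed
        finally show ?thesis using n by (simp add: field_simps)
      qed
      then show "\<exists>M. \<forall>n\<ge>M. (\<Sum>k=1..n. ?g t \<delta> (z n k)) / real n
          \<le> real N / real n + sqrt (max 0 (t + 2 * \<delta>) / c)"
        by (intro exI[of _ 1]) auto
    qed (use \<delta> in auto)
    finally show ?thesis by simp
  qed

  have lower: "min 1 (sqrt (max 0 (t - 2 * \<delta>) / c)) \<le> distribution_fun D \<omega> t"
    if \<delta>: "0 < \<delta>" "\<delta> \<le> 1" for \<delta>
  proof -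
    obtain N where N: "\<And>n k. k \<in> {N..n} \<Longrightarrow> cmod (z n k - of_real (c * (real k / real n)\<^sup>2)) \<le> \<delta>"
      using approx[OF \<delta>(1)] by blast
    let ?m = "min 1 (sqrt (max 0 (t - 2 * \<delta>) / c))"
    have "?m - 0 \<le> (LINT x|lebesgue_on D. ?g (t - \<delta>) \<delta> (complex_of_real (\<omega> x))) / measure lebesgue D"
    proof (rule LIMSEQ_le[OF _ lim_g])
      show "(\<lambda>n. ?m - (real N + 1) / real n) \<longlonglongrightarrow> ?m - 0"
        by (intro tendsto_intros lim_const_over_n)
      have "?m - (real N + 1) / real n \<le> (\<Sum>k=1..n. ?g (t - \<delta>) \<delta> (z n k)) / real n"
        if n: "0 < n" for n
      proof -
        define S where "S = {k\<in>{1..n}. c * (real k / real n)\<^sup>2 \<le> t - 2 * \<delta>}"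
        have "of_bool (k \<in> S) - of_bool (k < N) \<le> ?g (t - \<delta>) \<delta> (z n k)" if k: "k \<in> {1..n}" for k
        proof (cases "N \<le> k \<and> k \<in> S")
          case True
          let ?x = "c * (real k / real n)\<^sup>2"
          have near: "cmod (z n k - of_real ?x) \<le> \<delta>" using N[of k n] True k by auto
          then have "\<bar>Re (z n k - of_real ?x)\<bar> \<le> \<delta>" by (rule order_trans[OF abs_Re_le_cmod])
          then have Re: "Re (z n k) \<le> t - \<delta>" using True by (auto simp: S_def)
          have "real k / real n \<le> 1" using k by simp
          then have "?x \<le> c * 1" using c by (intro mult_left_mono power_le_one) auto
          moreover have "0 \<le> ?x" using c by simp
          ultimately have "cmod (of_real ?x) \<le> c" by (simp only: norm_of_real abs_of_nonneg)
          then have "cmod (z n k) \<le> R"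
            using norm_triangle_sub[of "z n k" "of_real ?x"] near \<delta>(2) unfolding R_def by linarith
          then show ?thesis using True Re \<delta> by (simp add: test_fun_def ramp_eq_1)
        next
          case False
          then show ?thesis using test_fun_bounds(1)[of R "t - \<delta>" \<delta> "z n k"] by (auto simp: of_bool_def)
        qed
        then have "(\<Sum>k=1..n. of_bool (k \<in> S) - of_bool (k < N)) \<le> (\<Sum>k=1..n. ?g (t - \<delta>) \<delta> (z n k))"
          by (rule sum_mono)
        moreover have "(\<Sum>k=1..n. of_bool (k \<in> S) - of_bool (k < N) :: real)
            = real (card ({1..n} \<inter> S)) - real (card ({1..n} \<inter> {k. k < N}))"
          by (simp add: sum_subtractf)
        moreover have "card ({1..n} \<inter> {k. k < N}) \<le> card {..<N}" by (intro card_mono) auto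
        moreover have "{1..n} \<inter> S = S" by (auto simp: S_def)
        ultimately have "real n * ?m - 1 - real N \<le> (\<Sum>k=1..n. ?g (t - \<delta>) \<delta> (z n k))"
          using card_scaled_squares_ge[OF c, of n "t - 2 * \<delta>"] unfolding S_def[symmetric] by simp
        then have "(real n * ?m - 1 - real N) / real n \<le> (\<Sum>k=1..n. ?g (t - \<delta>) \<delta> (z n k)) / real n"
          by (rule divide_right_mono) simp
        moreover have "(real n * ?m - 1 - real N) / real n = ?m - (real N + 1) / real n"
          using n by (simp add: diff_divide_distrib add_divide_distrib)
        ultimately show ?thesis by simp
      qed
      then show "\<exists>M. \<forall>n\<ge>M. ?m - (real N + 1) / real n \<le> (\<Sum>k=1..n. ?g (t - \<delta>) \<delta> (z n k)) / real n"
        by (intro exI[of _ 1]) auto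
    qed (use \<delta> in auto)
    also have "\<dots> \<le> distribution_fun D \<omega> t"
      unfolding dist
    proof (intro divide_right_mono integral_mono int_ind int_g)
      fix x assume "x \<in> space (lebesgue_on D)"
      then show "?g (t - \<delta>) \<delta> (complex_of_real (\<omega> x)) \<le> indicator {x\<in>D. \<omega> x \<le> t} x"
        using test_fun_bounds(2)[of R "t - \<delta>" \<delta> "complex_of_real (\<omega> x)"] \<delta>
        by (auto simp: indicator_def test_fun_def ramp_eq_0)
    qed (use \<delta> in auto)
    finally show ?thesis by simp
  qed

  let ?\<delta> = "\<lambda>m. inverse (real (Suc m))"
  have \<delta>: "0 < ?\<delta> m" "?\<delta> m \<le> 1" for m by (auto simp: inverse_eq_divide)
  have "(\<lambda>m. sqrt (max 0 (t + 2 * ?\<delta> m) / c)) \<longlonglongrightarrow> sqrt (max 0 (t + 2 * 0) / c)"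
    using c by (intro tendsto_intros LIMSEQ_inverse_real_of_nat) auto
  then show "distribution_fun D \<omega> t \<le> sqrt (max 0 t / c)"
    using LIMSEQ_le_const[of _ "sqrt (max 0 t / c)" "distribution_fun D \<omega> t"] upper[OF \<delta>(1)] by simp
  have "(\<lambda>m. min 1 (sqrt (max 0 (t - 2 * ?\<delta> m) / c))) \<longlonglongrightarrow> min 1 (sqrt (max 0 (t - 2 * 0) / c))"
    using c by (intro tendsto_intros LIMSEQ_inverse_real_of_nat) auto
  then show "min 1 (sqrt (max 0 t / c)) \<le> distribution_fun D \<omega> t"
    using LIMSEQ_le_const2[of _ "min 1 (sqrt (max 0 t / c))" "distribution_fun D \<omega> t"] lower[OF \<delta>] by simp
qed

lemma monotone_rearrangement_eq_if_scaled_squares: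
  fixes z :: "nat \<Rightarrow> nat \<Rightarrow> complex"
  assumes c: "0 < c"
    and lim: "\<And>F :: complex \<Rightarrow> complex. continuous_on UNIV F \<Longrightarrow> compact (closure {z. F z \<noteq> 0}) \<Longrightarrow>
        (\<lambda>n. (\<Sum>k=1..n. F (z n k)) / of_nat n)
          \<longlonglongrightarrow> (LINT x|lebesgue_on D. F (complex_of_real (\<omega> x))) / of_real (measure lebesgue D)"
    and approx: "\<And>\<eta>. 0 < \<eta> \<Longrightarrow> \<exists>N. \<forall>n. \<forall>k\<in>{N..n}.
        cmod (z n k - of_real (c * (real k / real n)\<^sup>2)) \<le> \<eta>"
    and x: "0 < x" "x \<le> 1"
  shows "monotone_rearrangement D \<omega> x = c * x\<^sup>2"
proof (rule monotone_rearrangement_eqI[OF x])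
  fix t
  note bounds = distribution_fun_bounds_if_scaled_squares[OF c lim approx, of t]
  show "x \<le> distribution_fun D \<omega> t \<longleftrightarrow> c * x\<^sup>2 \<le> t"
  proof
    assume "x \<le> distribution_fun D \<omega> t"
    then have "x \<le> sqrt (max 0 t / c)" using bounds(1) by simp
    then have "x\<^sup>2 \<le> max 0 t / c" using x by (metis less_imp_le real_le_rsqrt real_sqrt_le_iff real_sqrt_unique)
    then have *: "c * x\<^sup>2 \<le> max 0 t" using c by (simp add: field_simps)
    moreover have "0 < c * x\<^sup>2" using c x by simp
    ultimately show "c * x\<^sup>2 \<le> t" by linarith
  next
    assume "c * x\<^sup>2 \<le> t"
    then have "x\<^sup>2 \<le> max 0 t / c" using c by (simp add: field_simps)
    then have "x \<le> sqrt (max 0 t / c)" by (rule real_le_rsqrt)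
    then show "x \<le> distribution_fun D \<omega> t" using bounds(2) x by simp
  qed
qed

end

text \<open>For large \<open>k\<close> the eigenvalue of the matrix differs from \<open>lam k\<close> by a small multiple of
  \<open>lam k = O(k\<^sup>2)\<close>, and \<open>lam k\<close> differs from \<open>c k\<^sup>2\<close> by a small multiple of \<open>k\<^sup>2\<close>. Dividing by \<open>(n + 1)\<^sup>2\<close>
  makes both errors small, uniformly in \<open>k \<le> n\<close>.\<close>

lemma scaled_eigenvalues_approx:
  assumes weyl: "(\<lambda>k. lam k / (real k)\<^sup>2) \<longlonglongrightarrow> c" and c: "0 < c"
    and err: "max_relative_error L lam \<longlonglongrightarrow> 0" and \<eta>: "0 < \<eta>"
  shows "\<exists>N. \<forall>n. \<forall>k\<in>{N..n}. cmod (complex_of_real (1 / (real n + 1)\<^sup>2) * mat_eigenvalue (L n) k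
      - of_real (c * (real k / real n)\<^sup>2)) \<le> \<eta>"
proof -
  \<comment> \<open>the relative error costs \<open>\<epsilon> (c + 1) k\<^sup>2\<close> and the asymptotics cost \<open>\<epsilon> k\<^sup>2\<close>; \<open>\<epsilon> \<le> c\<close> keeps \<open>lam k\<close> positive\<close>
  define \<epsilon> where "\<epsilon> = min (min 1 c) (\<eta> / (2 * (c + 2)))"
  have \<epsilon>: "0 < \<epsilon>" "\<epsilon> \<le> 1" "\<epsilon> \<le> c" "\<epsilon> * (c + 2) \<le> \<eta> / 2"
  proof -
    show "0 < \<epsilon>" "\<epsilon> \<le> 1" "\<epsilon> \<le> c" using c \<eta> by (auto simp: \<epsilon>_def)
    have "\<epsilon> * (c + 2) \<le> \<eta> / (2 * (c + 2)) * (c + 2)"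
      using c by (intro mult_right_mono) (auto simp: \<epsilon>_def)
    also have "\<dots> = \<eta> / 2" using c by (simp add: field_simps)
    finally show "\<epsilon> * (c + 2) \<le> \<eta> / 2" .
  qed
  obtain N1 where N1: "\<And>k. k \<ge> N1 \<Longrightarrow> \<bar>lam k / (real k)\<^sup>2 - c\<bar> < \<epsilon>"
    using LIMSEQ_D[OF weyl \<epsilon>(1)] by auto
  obtain N2 where N2: "\<And>n. n \<ge> N2 \<Longrightarrow> \<bar>max_relative_error L lam n\<bar> < \<epsilon>"
    using LIMSEQ_D[OF err \<epsilon>(1)] by auto
  obtain N3 :: nat where N3: "4 * c / \<eta> \<le> real N3" using real_arch_simple by blast
  define N where "N = Suc (N1 + N2 + N3)"
  have "cmod (complex_of_real (1 / (real n + 1)\<^sup>2) * mat_eigenvalue (L n) k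
      - of_real (c * (real k / real n)\<^sup>2)) \<le> \<eta>" if k: "k \<in> {N..n}" for n k
  proof -
    let ?e = "mat_eigenvalue (L n) k"
    define K where "K = (real k)\<^sup>2"
    define n1 where "n1 = (real n + 1)\<^sup>2"
    have pos: "0 < K" "0 < n1" using k by (auto simp: K_def n1_def N_def)
    have K_le: "K \<le> n1" unfolding K_def n1_def using k by (intro power_mono) auto
    have w: "\<bar>lam k / K - c\<bar> < \<epsilon>" using N1[of k] k by (simp add: N_def K_def)
    then have "0 < lam k / K" using \<epsilon>(3) by linarith
    then have lam_pos: "0 < lam k" using pos by (simp add: zero_less_divide_iff)
    have lamc: "\<bar>lam k - c * K\<bar> \<le> \<epsilon> * K"
    proof -
      have "lam k - c * K = (lam k / K - c) * K" using pos by (simp add: field_simps)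
      then show ?thesis using w pos by (simp add: abs_mult)
    qed
    have "cmod (?e / of_real (lam k) - 1) \<le> max_relative_error L lam n"
      unfolding max_relative_error_def using k lam_pos by (intro Max_ge) (auto simp: N_def)
    also have "\<dots> \<le> \<epsilon>" using N2[of n] k by (simp add: N_def)
    finally have "cmod (?e / of_real (lam k) - 1) * lam k \<le> \<epsilon> * lam k"
      using lam_pos by (intro mult_right_mono) auto
    moreover have "?e - of_real (lam k) = (?e / of_real (lam k) - 1) * of_real (lam k)"
      using lam_pos by (simp add: field_simps)
    ultimately have el: "cmod (?e - of_real (lam k)) \<le> \<epsilon> * lam k"
      using lam_pos by (simp add: norm_mult)
    have "lam k \<le> (c + 1) * K"
    proof -
      have "\<epsilon> * K \<le> 1 * K" using \<epsilon>(2) pos by (intro mult_right_mono) auto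
      then show ?thesis using abs_le_D1[OF lamc] unfolding distrib_right by linarith
    qed
    then have "\<epsilon> * lam k \<le> \<epsilon> * ((c + 1) * K)" using \<epsilon>(1) by (intro mult_left_mono) auto
    with el have el': "cmod (?e - of_real (lam k)) \<le> \<epsilon> * (c + 1) * K" by simp
    have "cmod (?e - of_real (c * K)) \<le> cmod (?e - of_real (lam k)) + cmod (of_real (lam k - c * K))"
      using norm_triangle_ineq[of "?e - of_real (lam k)" "of_real (lam k - c * K)"] by simp
    also have "\<dots> \<le> \<epsilon> * (c + 1) * K + \<epsilon> * K"
      using el' lamc by (intro add_mono) (simp_all only: norm_of_real)
    also have "\<dots> = \<epsilon> * (c + 2) * K" by (simp add: algebra_simps)
    also have "\<dots> \<le> \<eta> / 2 * K" using \<epsilon>(4) pos by (intro mult_right_mono) auto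
    also have "\<dots> \<le> \<eta> / 2 * n1" using K_le \<eta> by (intro mult_left_mono) auto
    finally have "cmod (?e - of_real (c * K)) / n1 \<le> \<eta> / 2" using pos by (simp add: divide_le_eq)
    then have first: "cmod ((?e - of_real (c * K)) / of_real n1) \<le> \<eta> / 2"
      using pos by (simp add: norm_divide)
    have n: "0 < real n" using k by (auto simp: N_def)
    \<comment> \<open>the price of normalising by \<open>(n + 1)\<^sup>2\<close> instead of \<open>n\<^sup>2\<close>\<close>
    have second: "\<bar>c * K / n1 - c * (real k / real n)\<^sup>2\<bar> \<le> \<eta> / 2"
    proof -
      define y where "y = real n / (real n + 1)"
      have y: "0 \<le> y" "y \<le> 1" by (auto simp: y_def)
      have "c * K / n1 - c * (real k / real n)\<^sup>2 = - (c * ((real k / real n)\<^sup>2 * (1 - y\<^sup>2)))"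
        using n by (simp add: K_def n1_def y_def power_divide field_simps)
      moreover have "0 \<le> (real k / real n)\<^sup>2 * (1 - y\<^sup>2)"
        using y by (intro mult_nonneg_nonneg) (auto simp: abs_square_le_1)
      ultimately have "\<bar>c * K / n1 - c * (real k / real n)\<^sup>2\<bar> = c * ((real k / real n)\<^sup>2 * (1 - y\<^sup>2))"
        using c by (simp only: abs_minus_cancel abs_of_nonneg mult_nonneg_nonneg less_imp_le)
      also have "\<dots> \<le> c * (1 * (2 * (1 - y)))"
      proof (intro mult_left_mono mult_mono)
        show "(real k / real n)\<^sup>2 \<le> 1" using k n by (intro power_le_one) auto
        have "1 - y\<^sup>2 = (1 + y) * (1 - y)" by (simp add: power2_eq_square algebra_simps)
        also have "\<dots> \<le> 2 * (1 - y)" using y by (intro mult_right_mono) auto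
        finally show "1 - y\<^sup>2 \<le> 2 * (1 - y)" .
        show "0 \<le> 1 - y\<^sup>2" using y by (simp add: power_le_one)
      qed (use c in auto)
      also have "\<dots> = 2 * c / (real n + 1)" using n by (simp add: y_def field_simps)
      also have "\<dots> \<le> \<eta> / 2"
      proof -
        have "real N3 \<le> real n" using k by (simp add: N_def)
        then have "4 * c / \<eta> \<le> real n + 1" using N3 by linarith
        then show ?thesis using \<eta> n by (simp add: field_simps)
      qed
      finally show ?thesis .
    qed
    have "complex_of_real (1 / (real n + 1)\<^sup>2) * ?e - of_real (c * (real k / real n)\<^sup>2)
        = (?e - of_real (c * K)) / of_real n1 + of_real (c * K / n1 - c * (real k / real n)\<^sup>2)"
      by (simp add: n1_def[symmetric] diff_divide_distrib)
    also have "cmod \<dots> \<le> cmod ((?e - of_real (c * K)) / of_real n1)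
        + cmod (of_real (c * K / n1 - c * (real k / real n)\<^sup>2))" by (rule norm_triangle_ineq)
    also have "\<dots> \<le> \<eta> / 2 + \<eta> / 2"
      using first second by (intro add_mono) (simp_all only: norm_of_real)
    finally show ?thesis by simp
  qed
  then show ?thesis by blast
qed

section \<open>Failure of uniform relative approximation\<close>

lemma Ck_on_imp_continuous_on: "Ck_on k a b f \<Longrightarrow> continuous_on {a..b} f"
  by (cases k) (auto intro: DERIV_continuous_on)

theorem corollary5p1p3:
  fixes a b \<sigma>1 \<sigma>2 \<zeta>1 \<zeta>2 B :: real
    and p q w \<omega>_rearr :: "real \<Rightarrow> real"
    and L :: "nat \<Rightarrow> complex mat"
    and lam :: "nat \<Rightarrow> real"
    and \<omega> :: "real \<times> real \<Rightarrow> real"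
    and D :: "(real \<times> real) set"
  assumes ab: "a < b"
    and reg: "Ck_on 1 a b p" "Ck_on 1 a b w" "Ck_on 0 a b q" "Ck_on 2 a b (\<lambda>x. p x * w x)"
    and pos: "\<And>x. x \<in> {a..b} \<Longrightarrow> p x > 0" "\<And>x. x \<in> {a..b} \<Longrightarrow> w x > 0"
      "\<And>x. x \<in> {a..b} \<Longrightarrow> q x \<ge> 0"
    and bc: "\<sigma>1\<^sup>2 + \<sigma>2\<^sup>2 > 0" "\<zeta>1\<^sup>2 + \<zeta>2\<^sup>2 > 0"
    and lam: "lam = sl_eigenvalue a b p q w \<sigma>1 \<sigma>2 \<zeta>1 \<zeta>2"
    and B: "B = integral {a..b} (\<lambda>x. sqrt (w x / p x))"
    and D: "D = {a..b} \<times> {0..pi}"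
    and \<omega>_rearr: "\<omega>_rearr = monotone_rearrangement D \<omega>"
    and dim: "\<And>n. n \<ge> 1 \<Longrightarrow> L n \<in> carrier_mat n n"
    and conv: "\<And>k. k \<ge> 1 \<Longrightarrow> (\<lambda>n. mat_eigenvalue (L n) k) \<longlonglongrightarrow> complex_of_real (lam k)"
    and real_ev: "\<And>n k. n \<ge> 1 \<Longrightarrow> k \<in> {1..n} \<Longrightarrow> mat_eigenvalue (L n) k \<in> \<real>"
    and symbol: "has_spectral_symbol (\<lambda>n. complex_of_real (1 / (real n + 1)\<^sup>2) \<cdot>\<^sub>m L n) D
                   (\<lambda>z. complex_of_real (\<omega> z))"
    and Linf: "\<omega> \<in> borel_measurable (lebesgue_on D)"
      "\<exists>C. AE z in lebesgue_on D. \<bar>\<omega> z\<bar> \<le> C"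
    and plip: "piecewise_lipschitz_on 0 1 \<omega>_rearr"
  shows "((SUP x\<in>{0<..1}. ereal \<bar>\<omega>_rearr x / (x\<^sup>2 * pi\<^sup>2 / B\<^sup>2) - 1\<bar>) > 0 \<longrightarrow>
            \<not> max_relative_error L lam \<longlonglongrightarrow> 0) \<and>
         esssup (lebesgue_on D) (\<lambda>z. ereal (\<omega> z)) = ereal (\<omega>_rearr 1) \<and>
         (\<omega>_rearr 1 \<noteq> pi\<^sup>2 / B\<^sup>2 \<longrightarrow> \<not> max_relative_error L lam \<longlonglongrightarrow> 0)"
proof -
  have weyl: "(\<lambda>k. lam k / (real k)\<^sup>2) \<longlonglongrightarrow> pi\<^sup>2 / B\<^sup>2" and B_pos: "0 < B"
  proof -
    have cont: "continuous_on {a..b} p" "continuous_on {a..b} q" "continuous_on {a..b} w"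
      by (rule Ck_on_imp_continuous_on, rule reg)+
    have pw: "Ck_on 1 a b (\<lambda>x. p x * w x)"
    proof -
      obtain m where m: "\<forall>x\<in>{a..b}. ((\<lambda>x. p x * w x) has_real_derivative m x) (at x within {a..b})"
          "Ck_on (Suc 0) a b m"
        using reg(4) unfolding numeral_2_eq_2 Ck_on.simps(2)[of "Suc 0"] by blast
      show ?thesis
        unfolding One_nat_def Ck_on.simps using m(1) Ck_on_imp_continuous_on[OF m(2)] by blast
    qed
    show "(\<lambda>k. lam k / (real k)\<^sup>2) \<longlonglongrightarrow> pi\<^sup>2 / B\<^sup>2" "0 < B"
      unfolding lam B by (rule sl_eigenvalue_weyl_law[OF ab cont pos(1,2) pw bc]; assumption)+
  qed
  interpret bounded_symbol D \<omega>
    by unfold_locales (use symbol Linf in \<open>auto simp: has_spectral_symbol_def\<close>)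
  have lim: "(\<lambda>n. (\<Sum>k=1..n. F (complex_of_real (1 / (real n + 1)\<^sup>2) * mat_eigenvalue (L n) k)) / of_nat n)
      \<longlonglongrightarrow> (LINT z|lebesgue_on D. F (complex_of_real (\<omega> z))) / of_real (measure lebesgue D)"
    if "continuous_on UNIV F" "compact (closure {z. F z \<noteq> 0})" for F :: "complex \<Rightarrow> complex"
  proof -
    have "(\<Sum>k=1..n. F (mat_eigenvalue (complex_of_real (1 / (real n + 1)\<^sup>2) \<cdot>\<^sub>m L n) k))
        = (\<Sum>k=1..n. F (complex_of_real (1 / (real n + 1)\<^sup>2) * mat_eigenvalue (L n) k))" for n
    proof (cases "n = 0")
      case False
      have "1 / (real n + 1)\<^sup>2 \<noteq> 0" by (simp add: add_nonneg_eq_0_iff)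
      then have "complex_of_real (1 / (real n + 1)\<^sup>2) \<noteq> 0" by (simp only: of_real_eq_0_iff not_False_eq_True)
      with False show ?thesis by (intro sum_mat_eigenvalue_smult dim) auto
    qed simp
    moreover have "(\<lambda>n. (\<Sum>k=1..n. F (mat_eigenvalue (complex_of_real (1 / (real n + 1)\<^sup>2) \<cdot>\<^sub>m L n) k)) / of_nat n)
      \<longlonglongrightarrow> (LINT z|lebesgue_on D. F (complex_of_real (\<omega> z))) / of_real (measure lebesgue D)"
      using symbol that unfolding has_spectral_symbol_def by blast
    ultimately show ?thesis by simp
  qed
  have rearr: "\<omega>_rearr x = pi\<^sup>2 / B\<^sup>2 * x\<^sup>2"
    if err: "max_relative_error L lam \<longlonglongrightarrow> 0" and x: "0 < x" "x \<le> 1" for x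
  proof -
    have c: "0 < pi\<^sup>2 / B\<^sup>2" using B_pos by simp
    show ?thesis
      unfolding \<omega>_rearr
      by (rule monotone_rearrangement_eq_if_scaled_squares
          [OF c lim scaled_eigenvalues_approx[OF weyl c err] x])
  qed
  show ?thesis
  proof (intro conjI impI notI)
    assume err: "max_relative_error L lam \<longlonglongrightarrow> 0"
    have "(SUP x\<in>{0<..1}. ereal \<bar>\<omega>_rearr x / (x\<^sup>2 * pi\<^sup>2 / B\<^sup>2) - 1\<bar>) \<le> 0"
    proof (rule SUP_least)
      fix x :: real assume x: "x \<in> {0<..1}"
      then have "\<omega>_rearr x = pi\<^sup>2 / B\<^sup>2 * x\<^sup>2" by (intro rearr[OF err]) auto
      moreover have "pi\<^sup>2 / B\<^sup>2 * x\<^sup>2 / (x\<^sup>2 * pi\<^sup>2 / B\<^sup>2) = 1" using B_pos x by simp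
      ultimately have "\<omega>_rearr x / (x\<^sup>2 * pi\<^sup>2 / B\<^sup>2) = 1" by (simp only:)
      then show "ereal \<bar>\<omega>_rearr x / (x\<^sup>2 * pi\<^sup>2 / B\<^sup>2) - 1\<bar> \<le> 0"
        by (simp only: diff_self abs_zero zero_ereal_def order_refl)
    qed
    moreover assume "0 < (SUP x\<in>{0<..1}. ereal \<bar>\<omega>_rearr x / (x\<^sup>2 * pi\<^sup>2 / B\<^sup>2) - 1\<bar>)"
    ultimately show False by simp
  next
    show "esssup (lebesgue_on D) (\<lambda>z. ereal (\<omega> z)) = ereal (\<omega>_rearr 1)"
      by (simp only: \<omega>_rearr monotone_rearrangement_1 esssup_eq_Sup_ess_range)
  next
    assume "\<omega>_rearr 1 \<noteq> pi\<^sup>2 / B\<^sup>2" and "max_relative_error L lam \<longlonglongrightarrow> 0"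
    then show False using rearr[of 1] by simp
  qed
qed

end
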